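(* Let $m\ge1$ and let $u,v$ be eigenfunctions on the Vicsek set $\mathcal{VS}_2$ born on a level $m'<m$ and obtained by spectral decimation, both with the same graph eigenvalues $\lambda_{m-1}$ and $\lambda_m$ on levels $m-1$ and $m$. Then $$\langle u,v\rangle_m=N(m)\,\langle u,v\rangle_{m-1},\qquad N(m)=\frac15\cdot\frac{20-143\lambda_m+240\lambda_m^2-108\lambda_m^3}{4-29\lambda_m+60\lambda_m^2-36\lambda_m^3}.$$ Moreover, if $u$ and $v$ are eigenfunctions born on level $0$ with the same eigenvalue, with graph eigenvalues $(\lambda_m)_{m\ge0}$, then the following product converges and gives the inner product on $\mathcal{VS}_2$: $$\langle u,v\rangle=\int_{\mathcal{VS}_2}uv\,d\mu=\langle u,v\rangle_0\prod_{m=1}^\infty N(m).$$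
   Context: The Vicsek set $\mathcal{VS}_2$ is the self-similar set generated by $F_1(x)=x/3$, $F_2(x)=x/3+\frac23(1,0)$, $F_3(x)=x/3+\frac23(1,1)$, $F_4(x)=x/3+\frac23(0,1)$, $F_0(x)=x/3+\frac23(\frac12,\frac12)$. $V_0=\{q_1,q_2,q_3,q_4\}$ is the set of corners of the unit square, $V_m=\bigcup_iF_i(V_{m-1})$; for a word $w=(w_1,\dots,w_m)$, $F_w=F_{w_1}\circ\cdots\circ F_{w_m}$. $\Gamma_m$ is the graph on $V_m$ in which two distinct vertices are adjacent iff both lie in $F_w(V_0)$ for some word $w$ of length $m$. The graph Laplacian, with Neumann conditions, is $\Delta_mu(x)=\frac1{\deg x}\sum_{y\sim x}(u(y)-u(x))$ for all $x\in V_m$. $\mu$ is the self-similar probability measure giving each cell $F_w(\mathcal{VS}_2)$, $|w|=m$, mass $5^{-m}$. The graph inner product is $$\langle u,v\rangle_m=\tfrac14\,5^{-m}\sum_{|w|=m}\sum_{i=1}^4u(F_wq_i)\,v(F_wq_i).$$ The Neumann Laplacian on $\mathcal{VS}_2$ is $\Delta u=\lim_m15^m\Delta_mu$. Spectral decimation: let $R(\lambda)=36\lambda^3-48\lambda^2+15\lambda$. The values $\frac12$, $\frac43$, $\frac{7\pm\sqrt{17}}{12}$ (which include the zeros of $(1-2\lambda)(4-21\lambda+18\lambda^2)=4-29\lambda+60\lambda^2-36\lambda^3$) are forbidden as continued eigenvalues. An eigenfunction born on level $m'$ is a continuous function $u$ on $\mathcal{VS}_2$ such that for every $m\ge m'$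 the restriction $u|_{V_m}$ satisfies $-\Delta_mu=\lambda_mu$ on $V_m$, where $\lambda_{m'}=4/3$ (or $m'=0$ and $\lambda_0=0$), and for every $m>m'$, $\lambda_{m-1}=R(\lambda_m)$ with $\lambda_m$ not forbidden, and $\lambda_m$ is the smallest root of $R(\lambda)=\lambda_{m-1}$ for all but finitely many $m$. The $\lambda_m$ are called the graph eigenvalues of $u$; the eigenvalue of $u$ on $\mathcal{VS}_2$ is $\lim_m15^m\lambda_m$. *)

theory Defs
  imports "HOL-Probability.Probability"
begin

text \<open>Points of the plane are pairs of reals. The index 0 stands for the central map:
  \<open>vs_q 0\<close> is the fixed point of \<open>F\<^sub>0\<close>, and \<open>vs_q i\<close> is the corner \<open>q\<^sub>i\<close> for \<open>1 \<le> i \<le> 4\<close>.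
  Indices above 4 never occur.\<close>

definition vs_q :: "nat \<Rightarrow> real \<times> real" where
  "vs_q i = (if i = 1 then (0, 0) else if i = 2 then (1, 0) else if i = 3 then (1, 1)
             else if i = 4 then (0, 1) else (1/2, 1/2))"

definition vs_F :: "nat \<Rightarrow> real \<times> real \<Rightarrow> real \<times> real" where
  "vs_F i x = (1/3) *\<^sub>R x + (2/3) *\<^sub>R vs_q i"

definition vs_word_map :: "nat list \<Rightarrow> real \<times> real \<Rightarrow> real \<times> real" where
  "vs_word_map w = foldr (\<lambda>i g. vs_F i \<circ> g) w id"

definition vs_words :: "nat \<Rightarrow> nat list set" where
  "vs_words m = {w. length w = m \<and> set w \<subseteq> {0..4}}"

text \<open>The attractor of the iterated function system; it is well defined by
  \<open>vicsek_set_ex1\<close> below.\<close>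

definition vicsek_set :: "(real \<times> real) set" where
  "vicsek_set = (THE K. compact K \<and> K \<noteq> {} \<and> K = (\<Union>i\<in>{0..4}. vs_F i ` K))"

fun vs_V :: "nat \<Rightarrow> (real \<times> real) set" where
  "vs_V 0 = vs_q ` {1..4}"
| "vs_V (Suc m) = (\<Union>i\<in>{0..4}. vs_F i ` vs_V m)"

definition vs_adj :: "nat \<Rightarrow> real \<times> real \<Rightarrow> real \<times> real \<Rightarrow> bool" where
  "vs_adj m x y \<longleftrightarrow> x \<noteq> y \<and>
     (\<exists>w\<in>vs_words m. x \<in> vs_word_map w ` vs_V 0 \<and> y \<in> vs_word_map w ` vs_V 0)"

definition vs_deg :: "nat \<Rightarrow> real \<times> real \<Rightarrow> nat" where
  "vs_deg m x = card {y \<in> vs_V m. vs_adj m x y}"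

definition vs_laplacian :: "nat \<Rightarrow> (real \<times> real \<Rightarrow> real) \<Rightarrow> real \<times> real \<Rightarrow> real" where
  "vs_laplacian m u x =
     1 / real (vs_deg m x) * (\<Sum>y\<in>{y \<in> vs_V m. vs_adj m x y}. u y - u x)"

definition vs_inner :: "nat \<Rightarrow> (real \<times> real \<Rightarrow> real) \<Rightarrow> (real \<times> real \<Rightarrow> real) \<Rightarrow> real" where
  "vs_inner m u v = 1/4 * (1/5) ^ m *
     (\<Sum>w\<in>vs_words m. \<Sum>i=1..4. u (vs_word_map w (vs_q i)) * v (vs_word_map w (vs_q i)))"

text \<open>The self-similar probability measure on the plane, carried by the Vicsek set (the cell
  of the empty word). Such a measure exists by \<open>vicsek_measure_exists\<close> below, and it is unique.\<close>

definition is_vicsek_measure :: "(real \<times> real) measure \<Rightarrow> bool" where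
  "is_vicsek_measure \<mu> \<longleftrightarrow>
     prob_space \<mu> \<and> sets \<mu> = sets borel \<and>
     (\<forall>A\<in>sets borel. measure \<mu> A = 1/5 * (\<Sum>i=0..4. measure \<mu> (vs_F i -` A))) \<and>
     (\<forall>m. \<forall>w\<in>vs_words m. measure \<mu> (vs_word_map w ` vicsek_set) = (1/5) ^ m)"

definition vs_R :: "real \<Rightarrow> real" where
  "vs_R t = 36 * t ^ 3 - 48 * t ^ 2 + 15 * t"

definition vs_forbidden :: "real set" where
  "vs_forbidden = {1/2, 4/3, (7 + sqrt 17) / 12, (7 - sqrt 17) / 12}"

text \<open>\<open>vs_eigenfunction m' u lam\<close>: \<open>u\<close> is an eigenfunction born on level \<open>m'\<close> with graph
  eigenvalues \<open>lam m\<close>, \<open>m \<ge> m'\<close>. The values of \<open>lam\<close> below \<open>m'\<close>, and those of \<open>u\<close> off the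
  Vicsek set, are immaterial.\<close>

definition vs_eigenfunction ::
  "nat \<Rightarrow> (real \<times> real \<Rightarrow> real) \<Rightarrow> (nat \<Rightarrow> real) \<Rightarrow> bool" where
  "vs_eigenfunction m' u lam \<longleftrightarrow>
     continuous_on vicsek_set u \<and>
     (\<forall>m\<ge>m'. \<forall>x\<in>vs_V m. - vs_laplacian m u x = lam m * u x) \<and>
     (lam m' = 4/3 \<or> (m' = 0 \<and> lam 0 = 0)) \<and>
     (\<forall>m>m'. lam (m - 1) = vs_R (lam m) \<and> lam m \<notin> vs_forbidden) \<and>
     (\<forall>\<^sub>F m in sequentially.
        vs_R (lam m) = lam (m - 1) \<and> (\<forall>t. vs_R t = lam (m - 1) \<longrightarrow> lam m \<le> t))"

definition vs_eigenvalue :: "(nat \<Rightarrow> real) \<Rightarrow> real" where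
  "vs_eigenvalue lam = lim (\<lambda>m. 15 ^ m * lam m)"

definition vs_N :: "real \<Rightarrow> real" where
  "vs_N t = 1/5 * ((20 - 143 * t + 240 * t ^ 2 - 108 * t ^ 3) /
                   (4 - 29 * t + 60 * t ^ 2 - 36 * t ^ 3))"


subsection \<open>Well-definedness of the Vicsek set\<close>

definition vs_T :: "(real \<times> real) set \<Rightarrow> (real \<times> real) set" where
  "vs_T K = (\<Union>i\<in>{0..4}. vs_F i ` K)"

definition vs_square :: "(real \<times> real) set" where
  "vs_square = {0..1} \<times> {0..1}"

lemma vs_F_dist: "dist (vs_F i x) (vs_F i y) = dist x y / 3"
proof -
  have "vs_F i x - vs_F i y = (1/3) *\<^sub>R (x - y)"
    by (simp add: vs_F_def algebra_simps)
  then show ?thesis by (simp add: dist_norm)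
qed

lemma vs_F_inj: "inj (vs_F i)"
proof (rule injI)
  fix x y assume "vs_F i x = vs_F i y"
  then show "x = y" using vs_F_dist[of i x y] by simp
qed

lemma vs_F_cont: "continuous_on A (vs_F i)"
  unfolding vs_F_def by (intro continuous_intros)

lemma vs_q_square: "vs_q i \<in> vs_square"
  by (auto simp: vs_q_def vs_square_def)

lemma vs_F_square: "x \<in> vs_square \<Longrightarrow> vs_F i x \<in> vs_square"
  using vs_q_square[of i] by (cases x; cases "vs_q i") (auto simp: vs_F_def vs_square_def)

lemma vs_T_mono: "A \<subseteq> B \<Longrightarrow> vs_T A \<subseteq> vs_T B"
  unfolding vs_T_def by blast

lemma vs_T_compact: "compact A \<Longrightarrow> compact (vs_T A)"
  unfolding vs_T_def by (intro compact_UN compact_continuous_image vs_F_cont) auto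

lemma vs_T_nonempty: "A \<noteq> {} \<Longrightarrow> vs_T A \<noteq> {}"
  unfolding vs_T_def by auto

definition vs_S :: "nat \<Rightarrow> (real \<times> real) set" where
  "vs_S n = (vs_T ^^ n) vs_square"

lemma vs_S_Suc: "vs_S (Suc n) = vs_T (vs_S n)"
  by (simp add: vs_S_def)

lemma vs_S_decr: "vs_S (Suc n) \<subseteq> vs_S n"
proof (induction n)
  case 0
  show ?case using vs_F_square by (auto simp: vs_S_def vs_T_def)
next
  case (Suc n)
  then show ?case using vs_T_mono vs_S_Suc by metis
qed

lemma vs_S_antimono: "m \<le> n \<Longrightarrow> vs_S n \<subseteq> vs_S m"
  using lift_Suc_antimono_le[of vs_S] vs_S_decr by blast

lemma vs_S_compact: "compact (vs_S n)"
  by (induction n) (auto simp: vs_S_Suc vs_T_compact, simp add: vs_S_def vs_square_def compact_Times)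

lemma vs_S_nonempty: "vs_S n \<noteq> {}"
  by (induction n) (auto simp: vs_S_Suc vs_T_nonempty, simp add: vs_S_def vs_square_def)

lemma vs_S_Inter_fixed: "vs_T (\<Inter>n. vs_S n) = (\<Inter>n. vs_S n)"
proof
  show "vs_T (\<Inter>n. vs_S n) \<subseteq> (\<Inter>n. vs_S n)"
  proof (rule INT_greatest)
    fix n
    have "vs_T (\<Inter>n. vs_S n) \<subseteq> vs_T (vs_S n)" by (intro vs_T_mono) auto
    also have "\<dots> \<subseteq> vs_S n" using vs_S_decr[of n] by (simp add: vs_S_Suc)
    finally show "vs_T (\<Inter>n. vs_S n) \<subseteq> vs_S n" .
  qed
  show "(\<Inter>n. vs_S n) \<subseteq> vs_T (\<Inter>n. vs_S n)"
  proof
    fix x assume x: "x \<in> (\<Inter>n. vs_S n)"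
    show "x \<in> vs_T (\<Inter>n. vs_S n)"
    proof (rule ccontr)
      assume notin: "x \<notin> vs_T (\<Inter>n. vs_S n)"
      have "\<exists>n. x \<notin> vs_F i ` vs_S n" if "i \<in> {0..4}" for i
      proof (rule ccontr)
        assume "\<not> (\<exists>n. x \<notin> vs_F i ` vs_S n)"
        then have "\<forall>n. \<exists>y. y \<in> vs_S n \<and> x = vs_F i y" by blast
        then obtain g where g: "\<And>n. g n \<in> vs_S n" "\<And>n. x = vs_F i (g n)"
          by metis
        have "g 0 \<in> vs_S n" for n
        proof -
          have "g n = g 0"
            using injD[OF vs_F_inj trans[OF g(2)[symmetric] g(2)]] .
          then show ?thesis using g(1)[of n] by simp
        qed
        then have "g 0 \<in> (\<Inter>n. vs_S n)" by blast
        then have "x \<in> vs_T (\<Inter>n. vs_S n)" using that g(2)[of 0] unfolding vs_T_def by blast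
        with notin show False by blast
      qed
      then have "\<forall>i\<in>{0..4}. \<exists>n. x \<notin> vs_F i ` vs_S n" by blast
      then have "\<exists>f. \<forall>i\<in>{0..4}. x \<notin> vs_F i ` vs_S (f i)" by (rule bchoice)
      then obtain f where f: "\<And>i. i \<in> {0..4} \<Longrightarrow> x \<notin> vs_F i ` vs_S (f i)"
        by blast
      define N where "N = Max (f ` {0..4})"
      have "x \<notin> vs_F i ` vs_S N" if "i \<in> {0..4}" for i
      proof -
        have "f i \<le> N" unfolding N_def using that by (intro Max_ge) auto
        then have "vs_S N \<subseteq> vs_S (f i)" by (rule vs_S_antimono)
        then show ?thesis using f[OF that] by blast
      qed
      then have "x \<notin> vs_S (Suc N)" unfolding vs_S_Suc vs_T_def by blast
      then show False using x by blast
    qed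
  qed
qed

lemma vs_fixed_subset:
  assumes "compact K" "K = vs_T K" "compact L" "L \<noteq> {}" "L = vs_T L"
  shows "K \<subseteq> L"
proof (cases "K = {}")
  case False
  have "continuous_on K (\<lambda>x. infdist x L)" by (intro continuous_intros)
  then obtain x where x: "x \<in> K" "\<And>y. y \<in> K \<Longrightarrow> infdist y L \<le> infdist x L"
    using continuous_attains_sup[OF \<open>compact K\<close> False] by blast
  obtain i y where iy: "i \<in> {0..4}" "y \<in> K" "x = vs_F i y"
    using x(1) assms(2) unfolding vs_T_def by blast
  obtain z where z: "z \<in> L" "infdist y L = dist y z"
    using infdist_attains_inf[of L y] assms compact_imp_closed by blast
  have "vs_F i z \<in> L" using z(1) iy(1) assms(5) unfolding vs_T_def by blast
  then have "infdist x L \<le> dist x (vs_F i z)" by (rule infdist_le)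
  also have "\<dots> = infdist y L / 3" by (simp add: iy(3) vs_F_dist z(2))
  also have "\<dots> \<le> infdist x L / 3" using x(2)[OF iy(2)] by simp
  finally have "infdist x L \<le> 0" by simp
  then have "infdist y L = 0" if "y \<in> K" for y
    using x(2)[OF that] infdist_nonneg[of y L] by linarith
  then show ?thesis
    using in_closed_iff_infdist_zero[OF compact_imp_closed[OF assms(3)] assms(4)] by blast
qed auto

lemma vs_S_Inter:
  "compact (\<Inter>n. vs_S n) \<and> (\<Inter>n. vs_S n) \<noteq> {} \<and> (\<Inter>n. vs_S n) = vs_T (\<Inter>n. vs_S n)"
proof (intro conjI)
  show "compact (\<Inter>n. vs_S n)" by (rule compact_Inter) (auto simp: vs_S_compact)
  show "(\<Inter>n. vs_S n) \<noteq> {}"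
    using compact_nest[of vs_S] vs_S_compact vs_S_nonempty vs_S_antimono by blast
qed (simp add: vs_S_Inter_fixed)

lemma vicsek_set_ex1: "\<exists>!K. compact K \<and> K \<noteq> {} \<and> K = (\<Union>i\<in>{0..4}. vs_F i ` K)"
proof (rule ex1I)
  show "compact (\<Inter>n. vs_S n) \<and> (\<Inter>n. vs_S n) \<noteq> {} \<and>
      (\<Inter>n. vs_S n) = (\<Union>i\<in>{0..4}. vs_F i ` (\<Inter>n. vs_S n))"
    using vs_S_Inter unfolding vs_T_def[symmetric] .
  show "K = (\<Inter>n. vs_S n)" if "compact K \<and> K \<noteq> {} \<and> K = (\<Union>i\<in>{0..4}. vs_F i ` K)" for K
    using that vs_S_Inter vs_fixed_subset[of K "\<Inter>n. vs_S n"] vs_fixed_subset[of "\<Inter>n. vs_S n" K]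
    unfolding vs_T_def[symmetric] by blast
qed

lemma vicsek_set_props:
  "compact vicsek_set" "vicsek_set \<noteq> {}" "vicsek_set = (\<Union>i\<in>{0..4}. vs_F i ` vicsek_set)"
  using theI'[OF vicsek_set_ex1] unfolding vicsek_set_def[symmetric] by blast+

lemma vicsek_set_eq: "vicsek_set = (\<Inter>n. vs_S n)"
proof (rule subset_antisym)
  note V = vicsek_set_props[folded vs_T_def] and S = vs_S_Inter
  show "vicsek_set \<subseteq> (\<Inter>n. vs_S n)"
    using S by (intro vs_fixed_subset V(1) V(3)) blast+
  show "(\<Inter>n. vs_S n) \<subseteq> vicsek_set"
    using S by (intro vs_fixed_subset V) blast+
qed

lemma vicsek_set_square: "vicsek_set \<subseteq> vs_square"
proof -
  have "vicsek_set \<subseteq> vs_S 0" unfolding vicsek_set_eq by blast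
  then show ?thesis by (simp add: vs_S_def)
qed


subsection \<open>Existence of the self-similar measure\<close>

text \<open>The measure is the distribution of the point with a uniformly random address.\<close>

definition vs_code :: "nat stream \<Rightarrow> real \<times> real" where
  "vs_code s = (\<Sum>k. (1/3) ^ k *\<^sub>R ((2/3) *\<^sub>R vs_q (s !! k)))"

definition vs_mu :: "(real \<times> real) measure" where
  "vs_mu = distr (stream_space (measure_pmf (pmf_of_set {0..4::nat}))) borel vs_code"

lemma norm_vs_q: "norm (vs_q i) \<le> 2"
proof -
  have "norm (vs_q i) \<le> norm (fst (vs_q i)) + norm (snd (vs_q i))"
    by (metis norm_Pair_le prod.collapse)
  also have "\<dots> \<le> 2" by (auto simp: vs_q_def)
  finally show ?thesis .
qed

lemma vs_code_summable: "summable (\<lambda>k. (1/3) ^ k *\<^sub>R ((2/3) *\<^sub>R vs_q (s !! k)))"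
proof (rule summable_comparison_test')
  show "summable (\<lambda>k. (1/3::real) ^ k * 2)" by (intro summable_mult2 summable_geometric) auto
  show "norm ((1/3) ^ k *\<^sub>R ((2/3) *\<^sub>R vs_q (s !! k))) \<le> (1/3) ^ k * 2" for k
    using norm_vs_q[of "s !! k"] by (simp add: power_divide divide_simps)
qed

lemma vs_code_Cons: "vs_code (i ## s) = vs_F i (vs_code s)"
proof -
  have "vs_code (i ## s) = (2/3) *\<^sub>R vs_q i
      + (\<Sum>k. (1/3) *\<^sub>R ((1/3) ^ k *\<^sub>R ((2/3) *\<^sub>R vs_q (s !! k))))"
    unfolding vs_code_def
    using suminf_split_head[OF vs_code_summable, of "i ## s"] by (simp add: algebra_simps)
  also have "(\<Sum>k. (1/3) *\<^sub>R ((1/3) ^ k *\<^sub>R ((2/3) *\<^sub>R vs_q (s !! k)))) = (1/3) *\<^sub>R vs_code s"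
    unfolding vs_code_def by (rule suminf_scaleR_right[OF vs_code_summable, symmetric])
  finally show ?thesis by (simp add: vs_F_def)
qed

lemma vs_code_measurable[measurable]:
  "vs_code \<in> stream_space (measure_pmf p) \<rightarrow>\<^sub>M borel"
proof (rule borel_measurable_LIMSEQ_metric)
  show "(\<lambda>n. \<Sum>k<n. (1/3) ^ k *\<^sub>R ((2/3) *\<^sub>R vs_q (s !! k))) \<longlonglongrightarrow> vs_code s" for s
    unfolding vs_code_def using vs_code_summable by (rule summable_LIMSEQ)
  show "(\<lambda>s. \<Sum>k<n. (1/3) ^ k *\<^sub>R ((2/3) *\<^sub>R vs_q (s !! k)))
      \<in> borel_measurable (stream_space (measure_pmf p))" for n
    by measurable
qed

lemma vs_F_measurable[measurable]: "vs_F i \<in> borel \<rightarrow>\<^sub>M borel"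
  by (intro borel_measurable_continuous_onI vs_F_cont)

lemma vs_code_square: "vs_code s \<in> vs_square"
proof -
  have geo: "(\<lambda>k. (1/3) ^ k * (2/3)) sums (1::real)"
    using sums_mult2[OF geometric_sums[of "1/3::real"], of "2/3"] by simp
  have f: "(\<lambda>k. (1/3) ^ k * (2/3) * fst (vs_q (s !! k))) sums fst (vs_code s)"
    using bounded_linear.sums[OF bounded_linear_fst summable_sums[OF vs_code_summable[of s]]]
    by (simp add: vs_code_def mult.assoc)
  have g: "(\<lambda>k. (1/3) ^ k * (2/3) * snd (vs_q (s !! k))) sums snd (vs_code s)"
    using bounded_linear.sums[OF bounded_linear_snd summable_sums[OF vs_code_summable[of s]]]
    by (simp add: vs_code_def mult.assoc)
  have q: "0 \<le> fst (vs_q i)" "fst (vs_q i) \<le> 1" "0 \<le> snd (vs_q i)" "snd (vs_q i) \<le> 1" for i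
    by (auto simp: vs_q_def)
  have "fst (vs_code s) \<le> 1" "snd (vs_code s) \<le> 1"
    using sums_le[OF _ f geo] sums_le[OF _ g geo] q by (auto intro!: mult_left_le)
  moreover have "0 \<le> fst (vs_code s)" "0 \<le> snd (vs_code s)"
    using sums_le[OF _ sums_zero f] sums_le[OF _ sums_zero g] q by auto
  ultimately show ?thesis by (cases "vs_code s") (auto simp: vs_square_def)
qed

interpretation vs_mu: prob_space vs_mu
  unfolding vs_mu_def
  by (intro prob_space.prob_space_distr prob_space.prob_space_stream_space
      measure_pmf.prob_space_axioms vs_code_measurable)

lemma sets_vs_mu[simp, measurable_cong]: "sets vs_mu = sets borel"
  by (simp add: vs_mu_def)

lemma space_vs_mu[simp]: "space vs_mu = UNIV"
  by (simp add: vs_mu_def)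

lemma emeasure_vs_mu:
  assumes [measurable]: "A \<in> sets borel"
  shows "emeasure vs_mu A =
    (\<integral>\<^sup>+s. indicator A (vs_code s) \<partial>stream_space (measure_pmf (pmf_of_set {0..4::nat})))"
proof -
  have "emeasure vs_mu A = (\<integral>\<^sup>+x. indicator A x \<partial>vs_mu)"
    by simp
  also have "\<dots> = (\<integral>\<^sup>+s. indicator A (vs_code s) \<partial>stream_space (measure_pmf (pmf_of_set {0..4::nat})))"
    unfolding vs_mu_def by (rule nn_integral_distr) measurable
  finally show ?thesis .
qed

lemma vs_mu_self_similar:
  assumes [measurable]: "A \<in> sets borel"
  shows "measure vs_mu A = 1/5 * (\<Sum>i=0..4. measure vs_mu (vs_F i -` A))"
proof -
  let ?p = "pmf_of_set {0..4::nat}"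
  let ?S = "stream_space (measure_pmf ?p)"
  have vim: "vs_F i -` A \<in> sets borel" for i
    using measurable_sets[OF vs_F_measurable assms, of i] by simp
  have "emeasure vs_mu A = (\<integral>\<^sup>+s. indicator A (vs_code s) \<partial>?S)"
    by (rule emeasure_vs_mu) (rule assms)
  also have "\<dots> = (\<integral>\<^sup>+i. \<integral>\<^sup>+s. indicator A (vs_code (i ## s)) \<partial>?S \<partial>measure_pmf ?p)"
    by (rule prob_space.nn_integral_stream_space[OF measure_pmf.prob_space_axioms]) measurable
  also have "\<dots> = (\<integral>\<^sup>+i. emeasure vs_mu (vs_F i -` A) \<partial>measure_pmf ?p)"
  proof (rule nn_integral_cong)
    fix i
    have "(\<integral>\<^sup>+s. indicator A (vs_code (i ## s)) \<partial>?S)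
        = (\<integral>\<^sup>+s. indicator (vs_F i -` A) (vs_code s) \<partial>?S)"
      by (intro nn_integral_cong) (auto simp: vs_code_Cons indicator_def)
    also have "\<dots> = emeasure vs_mu (vs_F i -` A)"
      by (rule emeasure_vs_mu[symmetric]) (rule vim)
    finally show "(\<integral>\<^sup>+s. indicator A (vs_code (i ## s)) \<partial>?S) = emeasure vs_mu (vs_F i -` A)" .
  qed
  also have "\<dots> = (\<Sum>i\<in>{0..4}. emeasure vs_mu (vs_F i -` A)) / 5"
    by (subst nn_integral_pmf_of_set) auto
  also have "\<dots> = ennreal (1/5 * (\<Sum>i=0..4. measure vs_mu (vs_F i -` A)))"
    by (simp add: vs_mu.emeasure_eq_measure sum_ennreal sum_nonneg ennreal_mult[symmetric]
        divide_ennreal[symmetric] del: sum.atLeast0_atMost_Suc)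
  finally show ?thesis
    by (simp add: vs_mu.emeasure_eq_measure sum_nonneg)
qed

lemma vs_mu_S: "measure vs_mu (vs_S n) = 1"
proof (induction n)
  case 0
  have "vs_square \<in> sets borel"
    unfolding vs_square_def by (intro borel_closed closed_Times) auto
  moreover have "vs_code -` vs_square = UNIV" using vs_code_square by auto
  ultimately show ?case
    unfolding vs_S_def vs_mu_def
    by (simp add: measure_distr prob_space.prob_space prob_space.prob_space_stream_space
        measure_pmf.prob_space_axioms)
next
  case (Suc n)
  have b: "vs_S k \<in> sets borel" for k using vs_S_compact compact_imp_closed borel_closed by blast
  have "measure vs_mu (vs_F i -` vs_S (Suc n)) = 1" if "i \<in> {0..4}" for i
  proof (rule antisym)
    have "vs_S n \<subseteq> vs_F i -` vs_S (Suc n)" using that unfolding vs_S_Suc vs_T_def by blast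
    then have "measure vs_mu (vs_S n) \<le> measure vs_mu (vs_F i -` vs_S (Suc n))"
      using measurable_sets[OF vs_F_measurable b, of i "Suc n"]
      by (intro vs_mu.finite_measure_mono) auto
    then show "1 \<le> measure vs_mu (vs_F i -` vs_S (Suc n))" using Suc by simp
  qed simp
  then have "(\<Sum>i=0..4. measure vs_mu (vs_F i -` vs_S (Suc n))) = 5"
    by simp
  then show ?case using vs_mu_self_similar[OF b, of "Suc n"] by simp
qed

lemma vs_mu_vicsek_set: "measure vs_mu vicsek_set = 1"
proof -
  have b: "vs_S k \<in> sets vs_mu" for k
    using borel_closed[OF compact_imp_closed[OF vs_S_compact[of k]]] by simp
  have "(\<lambda>n. measure vs_mu (vs_S n)) \<longlonglongrightarrow> measure vs_mu (\<Inter>n. vs_S n)"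
  proof (rule vs_mu.finite_Lim_measure_decseq)
    show "range vs_S \<subseteq> sets vs_mu" using b by blast
    show "decseq vs_S" using vs_S_antimono by (simp add: decseq_def)
  qed
  then have "(\<lambda>n. 1) \<longlonglongrightarrow> measure vs_mu vicsek_set"
    unfolding vs_mu_S vicsek_set_eq .
  then show ?thesis
    using LIMSEQ_unique[OF tendsto_const] by metis
qed

lemma vs_square_borel: "vs_square \<in> sets borel"
  unfolding vs_square_def by (intro borel_closed closed_Times) auto

lemma vs_mu_off_square:
  assumes "A \<in> sets borel" "A \<inter> vs_square = {}"
  shows "measure vs_mu A = 0"
proof -
  have sq: "vs_square \<in> sets vs_mu" "measure vs_mu vs_square = 1"
    using vs_square_borel vs_mu_S[of 0] by (simp_all add: vs_S_def)
  have "measure vs_mu (A \<union> vs_square) = measure vs_mu A + measure vs_mu vs_square"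
    using assms sq(1) by (intro vs_mu.finite_measure_Union) simp_all
  moreover have "measure vs_mu (A \<union> vs_square) \<le> 1" by (rule vs_mu.prob_le_1)
  ultimately show ?thesis using sq measure_nonneg[of vs_mu A] by linarith
qed

lemma vs_mu_corner:
  assumes "k \<in> {1..4}"
  shows "measure vs_mu {vs_q k} = 0"
proof -
  have other: "measure vs_mu (vs_F i -` {vs_q k}) = 0" if "i \<noteq> k" "i \<in> {0..4}" for i
  proof (rule vs_mu_off_square)
    show "vs_F i -` {vs_q k} \<in> sets borel"
      using measurable_sets[OF vs_F_measurable, of "{vs_q k}" i] by simp
    have ik: "i = 0 \<or> i = 1 \<or> i = 2 \<or> i = 3 \<or> i = 4" "k = 1 \<or> k = 2 \<or> k = 3 \<or> k = 4"
      using that assms by auto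
    show "vs_F i -` {vs_q k} \<inter> vs_square = {}"
      using ik that(1) by (elim disjE) (auto simp: vs_F_def vs_q_def vs_square_def)
  qed
  have self: "vs_F k -` {vs_q k} = {vs_q k}"
  proof -
    have "vs_F k (vs_q k) = vs_q k"
      by (simp add: vs_F_def scaleR_left_distrib[symmetric])
    then have "vs_F k x = vs_q k \<longleftrightarrow> x = vs_q k" for x
      using injD[OF vs_F_inj, of k x "vs_q k"] by metis
    then show ?thesis by (simp add: set_eq_iff)
  qed
  have "(\<Sum>i=0..4. measure vs_mu (vs_F i -` {vs_q k}))
      = (\<Sum>i\<in>{k}. measure vs_mu (vs_F i -` {vs_q k}))"
    using assms other by (intro sum.mono_neutral_right) auto
  then show ?thesis using vs_mu_self_similar[of "{vs_q k}"] self by simp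
qed

lemma vs_F_overlap:
  assumes "i \<noteq> j" "i \<in> {0..4}" "j \<in> {0..4}" "A \<subseteq> vs_square"
  shows "(vs_F j -` vs_F i ` A) \<inter> vs_square \<subseteq> vs_q ` {1..4}"
proof
  fix y assume "y \<in> (vs_F j -` vs_F i ` A) \<inter> vs_square"
  then obtain x where x: "x \<in> vs_square" "y \<in> vs_square" "vs_F j y = vs_F i x"
    using assms by auto
  have "i = 0 \<or> i = 1 \<or> i = 2 \<or> i = 3 \<or> i = 4" "j = 0 \<or> j = 1 \<or> j = 2 \<or> j = 3 \<or> j = 4"
    using assms by auto
  note ij = this
  obtain a b c d where ab: "x = (a, b)" "y = (c, d)" by (cases x; cases y) blast
  have cd: "c = a + 2 * (fst (vs_q i) - fst (vs_q j))" "d = b + 2 * (snd (vs_q i) - snd (vs_q j))"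
    using x(3) ab by (auto simp: vs_F_def prod_eq_iff)
  have bounds: "0 \<le> a" "a \<le> 1" "0 \<le> b" "b \<le> 1" "0 \<le> c" "c \<le> 1" "0 \<le> d" "d \<le> 1"
    using x(1,2) ab by (auto simp: vs_square_def)
  define p r where "p = 2 * (fst (vs_q i) - fst (vs_q j))" and "r = 2 * (snd (vs_q i) - snd (vs_q j))"
  have "p = 2 \<or> p = -2 \<or> r = 2 \<or> r = -2 \<or> ((p = 1 \<or> p = -1) \<and> (r = 1 \<or> r = -1))"
    using ij assms(1) unfolding p_def r_def by (elim disjE) (simp_all add: vs_q_def)
  moreover have "p \<noteq> 2" "p \<noteq> -2" "r \<noteq> 2" "r \<noteq> -2"
    using cd bounds unfolding p_def[symmetric] r_def[symmetric] by linarith+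
  moreover have "p = 1 \<Longrightarrow> c = 1" "p = -1 \<Longrightarrow> c = 0" "r = 1 \<Longrightarrow> d = 1" "r = -1 \<Longrightarrow> d = 0"
    using cd bounds unfolding p_def[symmetric] r_def[symmetric] by linarith+
  ultimately have "(c = 0 \<or> c = 1) \<and> (d = 0 \<or> d = 1)"
    by blast
  then have "y = (0,0) \<or> y = (1,0) \<or> y = (1,1) \<or> y = (0,1)"
    using ab by auto
  moreover have "(0,0) = vs_q 1" "(1,0) = vs_q 2" "(1,1) = vs_q 3" "(0,1) = vs_q 4"
    by (auto simp: vs_q_def)
  ultimately show "y \<in> vs_q ` {1..4}" by auto
qed

lemma vs_mu_F_image:
  assumes "compact A" "A \<subseteq> vs_square" "i \<in> {0..4}"
  shows "measure vs_mu (vs_F i ` A) = measure vs_mu A / 5"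
proof -
  have b: "vs_F i ` A \<in> sets borel"
    using compact_continuous_image[OF vs_F_cont assms(1)] compact_imp_closed borel_closed by blast
  have bj: "vs_F j -` vs_F i ` A \<in> sets borel" for j
    using measurable_sets[OF vs_F_measurable b, of j] by simp
  have other: "measure vs_mu (vs_F j -` vs_F i ` A) = 0" if j: "j \<noteq> i" "j \<in> {0..4}" for j
  proof -
    let ?B = "vs_F j -` vs_F i ` A"
    have c: "finite (vs_q ` {1..4})" by simp
    have cb: "vs_q ` {1..4} \<in> sets borel" using finite_imp_closed[OF c] borel_closed by blast
    have sq: "vs_square \<in> sets borel"
      by (rule vs_square_borel)
    have "measure vs_mu ?B \<le> measure vs_mu (\<Union> ((\<lambda>k. {vs_q k}) ` {1..4}) \<union> (?B - vs_square))"
      using vs_F_overlap[of i j A] assms j bj cb sq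
      by (intro vs_mu.finite_measure_mono) auto
    also have "\<dots> \<le> measure vs_mu (\<Union> ((\<lambda>k. {vs_q k}) ` {1..4})) + measure vs_mu (?B - vs_square)"
      using bj cb sq by (intro measure_Un_le) auto
    also have "measure vs_mu (?B - vs_square) = 0"
      using bj sq by (intro vs_mu_off_square) auto
    also have "measure vs_mu (\<Union> ((\<lambda>k. {vs_q k}) ` {1..4})) \<le> (\<Sum>k\<in>{1..4}. measure vs_mu {vs_q k})"
      by (intro measure_UNION_le) auto
    also have "\<dots> = 0" using vs_mu_corner by simp
    finally show ?thesis using measure_nonneg[of vs_mu ?B] by linarith
  qed
  have "(\<Sum>j=0..4. measure vs_mu (vs_F j -` vs_F i ` A))
      = (\<Sum>j\<in>{i}. measure vs_mu (vs_F j -` vs_F i ` A))"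
    using assms other by (intro sum.mono_neutral_right) auto
  then show ?thesis
    using vs_mu_self_similar[OF b] by (simp add: inj_vimage_image_eq[OF vs_F_inj])
qed

lemma vs_word_cell: "compact (vs_word_map w ` vicsek_set) \<and> vs_word_map w ` vicsek_set \<subseteq> vs_square"
proof (induction w)
  case Nil
  then show ?case using vicsek_set_props(1) vicsek_set_square by (simp add: vs_word_map_def)
next
  case (Cons i w)
  have "vs_word_map (i # w) ` vicsek_set = vs_F i ` vs_word_map w ` vicsek_set"
    by (auto simp: vs_word_map_def)
  then show ?case
    using Cons compact_continuous_image[OF vs_F_cont] vs_F_square by (metis image_subset_iff subsetD)
qed

lemma vs_mu_cell:
  "set w \<subseteq> {0..4} \<Longrightarrow> measure vs_mu (vs_word_map w ` vicsek_set) = (1/5) ^ length w"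
proof (induction w)
  case Nil
  then show ?case by (simp add: vs_word_map_def vs_mu_vicsek_set)
next
  case (Cons i w)
  have "vs_word_map (i # w) ` vicsek_set = vs_F i ` vs_word_map w ` vicsek_set"
    by (auto simp: vs_word_map_def)
  then show ?case using Cons vs_mu_F_image[of "vs_word_map w ` vicsek_set" i] vs_word_cell[of w] by simp
qed

lemma vicsek_measure_exists: "\<exists>\<mu>. is_vicsek_measure \<mu>"
  unfolding is_vicsek_measure_def
  using vs_mu.prob_space_axioms vs_mu_self_similar vs_mu_cell
  by (intro exI[of _ vs_mu]) (auto simp: vs_words_def)

end

theory Submission
  imports Defs
begin

text \<open>On each cell of level \<open>m - 1\<close> the eigenvalue equation at level \<open>m\<close> is a linear system for the
  values at the new vertices. Its solution depends on each corner value and on the sum of the four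
  corner values only, so the level \<open>m\<close> product sum over the cell is a combination of
  \<open>\<Sum>\<^sub>i u(q\<^sub>i) v(q\<^sub>i)\<close> and \<open>(\<Sum>\<^sub>i u(q\<^sub>i)) (\<Sum>\<^sub>j v(q\<^sub>j))\<close>. Summed over all cells, the second kind of term is
  \<open>4 - 3 \<lambda>\<^bsub>m-1\<^esub>\<close> times the first kind, by the eigenvalue equation at level \<open>m - 1\<close>.

  For the limit, \<open>\<lambda>\<^sub>m\<close> eventually decreases at least by a factor \<open>8\<close> in each step, while
  \<open>N(m) - 1 = O(\<lambda>\<^sub>m)\<close>, so the product converges; the graph inner products are Riemann sums. Two
  sequences of graph eigenvalues with the same limit agree, since \<open>15\<^sup>m \<bar>\<lambda>\<^sub>m - \<lambda>'\<^sub>m\<bar>\<close> is eventually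
  nondecreasing.\<close>

section \<open>Cells\<close>

declare vs_V.simps(1) [simp del]

lemma vs_word_map_Nil [simp]: "vs_word_map [] = id"
  by (simp add: vs_word_map_def)

lemma vs_word_map_Cons [simp]: "vs_word_map (i # w) x = vs_F i (vs_word_map w x)"
  by (simp add: vs_word_map_def)

lemma vs_word_map_append: "vs_word_map (w @ w') x = vs_word_map w (vs_word_map w' x)"
  by (induction w) auto

lemma vs_word_map_inj: "inj (vs_word_map w)"
proof (induction w)
  case (Cons i w)
  have "vs_word_map (i # w) = vs_F i \<circ> vs_word_map w" by auto
  then show ?case using inj_compose[OF vs_F_inj Cons] by metis
qed simp

lemma vs_word_map_eq_iff [simp]: "vs_word_map w x = vs_word_map w y \<longleftrightarrow> x = y"
  using vs_word_map_inj by (metis injD)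

lemma vs_F_eq_iff [simp]: "vs_F i x = vs_F i y \<longleftrightarrow> x = y"
  using vs_F_inj by (metis injD)

lemma vs_word_map_square: "x \<in> vs_square \<Longrightarrow> vs_word_map w x \<in> vs_square"
  by (induction w) (auto simp: vs_F_square)

lemma dist_vs_word_map: "dist (vs_word_map w x) (vs_word_map w y) = (1/3) ^ length w * dist x y"
  by (induction w) (auto simp: vs_F_dist)

lemma finite_vs_words [simp]: "finite (vs_words m)"
  unfolding vs_words_def using finite_lists_length_eq[of "{0..4::nat}" m]
  by (simp add: conj_commute)

lemma vs_words_0: "vs_words 0 = {[]}"
  by (auto simp: vs_words_def)

lemma vs_words_Suc: "vs_words (Suc m) = (\<lambda>(i, w). i # w) ` ({0..4} \<times> vs_words m)"
  by (auto simp: vs_words_def length_Suc_conv image_iff)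

lemma vs_words_Suc_snoc: "vs_words (Suc m) = (\<lambda>(w, i). w @ [i]) ` (vs_words m \<times> {0..4})"
  by (auto simp: vs_words_def length_Suc_conv_rev image_iff)

lemma sum_vs_words_Suc_snoc:
  "(\<Sum>w\<in>vs_words (Suc m). f w) = (\<Sum>w\<in>vs_words m. \<Sum>i\<in>{0..4}. f (w @ [i]))"
  unfolding vs_words_Suc_snoc sum.cartesian_product
  by (subst sum.reindex) (auto simp: inj_on_def case_prod_beta)

definition vs_cell :: "nat list \<Rightarrow> (real \<times> real) set" where
  "vs_cell w = vs_word_map w ` vs_V 0"

lemma vs_cell_Cons: "vs_cell (i # w) = vs_F i ` vs_cell w"
  by (auto simp: vs_cell_def)

lemma finite_vs_cell [simp]: "finite (vs_cell w)"
  by (simp add: vs_cell_def vs_V.simps(1))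

lemma vs_V_square: "vs_V 0 \<subseteq> vs_square"
  using vs_q_square by (auto simp: vs_V.simps(1))

lemma vs_cell_square: "vs_cell w \<subseteq> vs_square"
  using vs_V_square vs_word_map_square unfolding vs_cell_def by blast

lemma vs_V_eq_UN_cell: "vs_V m = (\<Union>w\<in>vs_words m. vs_cell w)"
proof (induction m)
  case 0
  show ?case by (simp add: vs_words_0 vs_cell_def)
next
  case (Suc m)
  have "(\<Union>w\<in>vs_words (Suc m). vs_cell w) = (\<Union>i\<in>{0..4}. \<Union>w\<in>vs_words m. vs_F i ` vs_cell w)"
    unfolding vs_words_Suc vs_cell_Cons[symmetric] by force
  then show ?case unfolding vs_V.simps(2) Suc image_UN by simp
qed

lemma finite_vs_V: "finite (vs_V m)"
  by (simp add: vs_V_eq_UN_cell)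

lemma inj_on_vs_q: "inj_on vs_q {1..4}"
proof -
  have "{1..4} = {1, 2, 3, 4::nat}" by auto
  then show ?thesis by (simp add: vs_q_def)
qed

lemma sum_vs_cell: "(\<Sum>x\<in>vs_cell w. f x) = (\<Sum>i=1..4. f (vs_word_map w (vs_q i)))"
proof -
  have "inj_on (vs_word_map w) (vs_q ` {1..4})"
    using vs_word_map_inj inj_on_subset by blast
  then show ?thesis
    unfolding vs_cell_def vs_V.simps(1) by (simp add: sum.reindex inj_on_vs_q del: One_nat_def)
qed

lemma card_vs_cell: "card (vs_cell w) = 4"
  using sum_vs_cell[of "\<lambda>_. 1::nat" w] by simp

section \<open>Intersections of cells of one level\<close>

text \<open>Corners are the extreme points of the unit square, and \<open>vs_F i\<close> maps the
  square affinely and injectively into itself, so the preimage of an extreme point is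
  extreme.\<close>

lemma vs_F_corner:
  assumes "x \<in> vs_square" "i \<in> {0..4}" "vs_F i x \<in> vs_V 0"
  shows "x \<in> vs_V 0"
proof -
  have "{1..4} = {1, 2, 3, 4::nat}" by auto
  moreover have "i = 0 \<or> i = 1 \<or> i = 2 \<or> i = 3 \<or> i = 4" using assms by auto
  moreover obtain a b where "x = (a, b)" by force
  ultimately show ?thesis using assms(1,3)
    by (elim disjE) (auto simp: vs_V.simps(1) vs_F_def vs_q_def vs_square_def)
qed

lemma vs_word_map_corner:
  "x \<in> vs_square \<Longrightarrow> set w \<subseteq> {0..4} \<Longrightarrow> vs_word_map w x \<in> vs_V 0 \<Longrightarrow> x \<in> vs_V 0"
proof (induction w)
  case (Cons i w)
  then show ?case using vs_F_corner[of "vs_word_map w x" i] vs_word_map_square[of x w] by simp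
qed simp

text \<open>The central square touches each outer square in a single corner, and the outer squares
  are pairwise disjoint.\<close>

lemma vs_F_square_overlap:
  assumes "i \<noteq> j" "i \<in> {0..4}" "j \<in> {0..4}"
    and "x \<in> vs_F i ` vs_square" "x \<in> vs_F j ` vs_square"
    and "y \<in> vs_F i ` vs_square" "y \<in> vs_F j ` vs_square"
  shows "x = y"
proof -
  have "i = 0 \<or> i = 1 \<or> i = 2 \<or> i = 3 \<or> i = 4" "j = 0 \<or> j = 1 \<or> j = 2 \<or> j = 3 \<or> j = 4"
    using assms by auto
  then show ?thesis using assms(1,4-)
    by (elim disjE) (auto simp: vs_F_def vs_q_def vs_square_def)
qed

text \<open>Equal first letters are cancelled; with different ones \<open>vs_F_overlap\<close> puts
  the point at a corner one level down, and \<open>vs_word_map_corner\<close> pulls this back to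
  \<open>x\<close>. Full squares replace vertex sets so that the result serves both the graphs and
  the measure.\<close>

lemma vs_word_map_overlap:
  assumes "w \<in> vs_words m" "w' \<in> vs_words m" "w \<noteq> w'"
    and "x \<in> vs_square" "vs_word_map w x \<in> vs_word_map w' ` vs_square"
  shows "x \<in> vs_V 0"
  using assms
proof (induction m arbitrary: w w')
  case 0
  then show ?case by (simp add: vs_words_0)
next
  case (Suc m)
  obtain i s j t where ij: "w = i # s" "w' = j # t" "i \<in> {0..4}" "j \<in> {0..4}"
      "s \<in> vs_words m" "t \<in> vs_words m"
    using Suc.prems(1,2) unfolding vs_words_Suc by fastforce
  obtain y where y: "y \<in> vs_square" "vs_F i (vs_word_map s x) = vs_F j (vs_word_map t y)"
    using Suc.prems(5) ij by auto
  show ?case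
  proof (cases "i = j")
    case True
    then show ?thesis using Suc ij y by auto
  next
    case False
    have "vs_word_map s x \<in> (vs_F i -` vs_F j ` vs_square) \<inter> vs_square"
      using y vs_word_map_square Suc.prems(4) by auto
    then have "vs_word_map s x \<in> vs_V 0"
      using vs_F_overlap[of j i vs_square] False ij(3,4) unfolding vs_V.simps(1) by blast
    then show ?thesis
      using vs_word_map_corner[OF Suc.prems(4)] ij(5) unfolding vs_words_def by blast
  qed
qed

text \<open>This keeps neighbours from being counted twice: two cells through a vertex have no other
  vertex in common.\<close>

lemma vs_cell_overlap:
  assumes "w \<in> vs_words m" "w' \<in> vs_words m" "w \<noteq> w'"
    and "x \<in> vs_cell w" "x \<in> vs_cell w'" "y \<in> vs_cell w" "y \<in> vs_cell w'"
  shows "x = y"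
  using assms
proof (induction m arbitrary: w w' x y)
  case 0
  then show ?case by (simp add: vs_words_0)
next
  case (Suc m)
  obtain i s j t where ij: "w = i # s" "w' = j # t" "i \<in> {0..4}" "j \<in> {0..4}"
      "s \<in> vs_words m" "t \<in> vs_words m"
    using Suc.prems(1,2) unfolding vs_words_Suc by fastforce
  show ?case
  proof (cases "i = j")
    case True
    then show ?thesis using Suc ij by (auto simp: vs_cell_Cons)
  next
    case False
    then show ?thesis
      using Suc.prems vs_F_square_overlap[OF False ij(3,4), of x y] vs_cell_square[of s]
        vs_cell_square[of t] unfolding ij vs_cell_Cons by blast
  qed
qed

section \<open>The eigenvalue equation in terms of cells\<close>

definition vs_csum :: "(real \<times> real \<Rightarrow> real) \<Rightarrow> nat list \<Rightarrow> real" where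
  "vs_csum u w = (\<Sum>x\<in>vs_cell w. u x)"

definition vs_star :: "nat \<Rightarrow> real \<times> real \<Rightarrow> nat list set" where
  "vs_star m x = {w \<in> vs_words m. x \<in> vs_cell w}"

lemma sum_vs_nbrs:
  "(\<Sum>y\<in>{y \<in> vs_V m. vs_adj m x y}. f y) = (\<Sum>w\<in>vs_star m x. \<Sum>y\<in>vs_cell w - {x}. f y)"
proof -
  have "{y \<in> vs_V m. vs_adj m x y} = (\<Union>w\<in>vs_star m x. vs_cell w - {x})"
    unfolding vs_adj_def vs_star_def vs_cell_def[symmetric] vs_V_eq_UN_cell[of m] by blast
  moreover have "(\<Sum>y\<in>(\<Union>w\<in>vs_star m x. vs_cell w - {x}). f y)
      = (\<Sum>w\<in>vs_star m x. \<Sum>y\<in>vs_cell w - {x}. f y)"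
  proof (rule sum.UNION_disjoint)
    show "\<forall>w\<in>vs_star m x. \<forall>w'\<in>vs_star m x.
        w \<noteq> w' \<longrightarrow> (vs_cell w - {x}) \<inter> (vs_cell w' - {x}) = {}"
      using vs_cell_overlap unfolding vs_star_def by blast
  qed (auto simp: vs_star_def)
  ultimately show ?thesis by simp
qed

text \<open>Each cell is a complete graph on four vertices, so \<open>x\<close> has three neighbours
  in every cell of its star. The eigenvalue equation thus says that the mean of the cell sums around
  \<open>x\<close> is \<open>(4 - 3 * t) * u x\<close>.\<close>

lemma vs_cell_equation:
  assumes "x \<in> vs_V m" "- vs_laplacian m u x = t * u x"
  shows "(\<Sum>w\<in>vs_star m x. vs_csum u w) = real (card (vs_star m x)) * (4 - 3 * t) * u x"
proof -
  let ?A = "{y \<in> vs_V m. vs_adj m x y}" and ?n = "real (card (vs_star m x))"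
  have fin: "finite (vs_star m x)" by (simp add: vs_star_def)
  have "vs_star m x \<noteq> {}" using assms(1) by (auto simp: vs_V_eq_UN_cell vs_star_def)
  then have n: "?n > 0" using fin by (simp add: card_gt_0_iff)
  have x: "x \<in> vs_cell w" if "w \<in> vs_star m x" for w using that by (simp add: vs_star_def)
  have "real (vs_deg m x) = (\<Sum>y\<in>?A. 1)" by (simp add: vs_deg_def)
  also have "\<dots> = (\<Sum>w\<in>vs_star m x. \<Sum>y\<in>vs_cell w - {x}. 1)" by (rule sum_vs_nbrs)
  also have "\<dots> = (\<Sum>w\<in>vs_star m x. 3)"
    using x by (intro sum.cong refl) (simp add: card_vs_cell)
  finally have deg: "real (vs_deg m x) = 3 * ?n" by simp
  have "(\<Sum>y\<in>?A. u y - u x) = (\<Sum>w\<in>vs_star m x. \<Sum>y\<in>vs_cell w - {x}. u y - u x)"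
    by (rule sum_vs_nbrs)
  also have "\<dots> = (\<Sum>w\<in>vs_star m x. vs_csum u w - 4 * u x)"
  proof (intro sum.cong refl)
    fix w assume "w \<in> vs_star m x"
    then show "(\<Sum>y\<in>vs_cell w - {x}. u y - u x) = vs_csum u w - 4 * u x"
      using x by (simp add: sum_subtractf sum_diff1 card_vs_cell vs_csum_def)
  qed
  also have "\<dots> = (\<Sum>w\<in>vs_star m x. vs_csum u w) - 4 * ?n * u x"
    by (simp add: sum_subtractf)
  finally show ?thesis using assms(2) n
    by (simp add: vs_laplacian_def deg field_simps)
qed

text \<open>Expanding the cell sum of \<open>u\<close> and exchanging the sums collects the cell
  sums of \<open>v\<close> around each vertex, where \<open>vs_cell_equation\<close> applies; the
  factor \<open>card (vs_star m x)\<close> turns the result back into a sum over cells.\<close>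

lemma sum_vs_csum_mult:
  assumes "\<And>x. x \<in> vs_V m \<Longrightarrow> - vs_laplacian m v x = t * v x"
  shows "(\<Sum>w\<in>vs_words m. vs_csum u w * vs_csum v w)
    = (4 - 3 * t) * (\<Sum>w\<in>vs_words m. \<Sum>x\<in>vs_cell w. u x * v x)"
proof -
  have swap: "(\<Sum>w\<in>vs_words m. \<Sum>x\<in>vs_cell w. f x w) = (\<Sum>x\<in>vs_V m. \<Sum>w\<in>vs_star m x. f x w)"
    for f :: "real \<times> real \<Rightarrow> nat list \<Rightarrow> real"
  proof -
    have "vs_cell w = {x \<in> vs_V m. x \<in> vs_cell w}" if "w \<in> vs_words m" for w
      using that unfolding vs_V_eq_UN_cell by blast
    then have "(\<Sum>w\<in>vs_words m. \<Sum>x\<in>vs_cell w. f x w)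
        = (\<Sum>w\<in>vs_words m. \<Sum>x\<in>{x \<in> vs_V m. x \<in> vs_cell w}. f x w)"
      by (intro sum.cong[OF refl]) simp
    also have "\<dots> = (\<Sum>x\<in>vs_V m. \<Sum>w\<in>{w \<in> vs_words m. x \<in> vs_cell w}. f x w)"
      by (rule sum.swap_restrict) (simp_all add: finite_vs_V)
    finally show ?thesis by (simp add: vs_star_def)
  qed
  have "(\<Sum>w\<in>vs_words m. vs_csum u w * vs_csum v w)
      = (\<Sum>w\<in>vs_words m. \<Sum>x\<in>vs_cell w. u x * vs_csum v w)"
    by (simp add: vs_csum_def[of u] sum_distrib_right)
  also have "\<dots> = (\<Sum>x\<in>vs_V m. u x * (\<Sum>w\<in>vs_star m x. vs_csum v w))"
    unfolding swap by (simp add: sum_distrib_left)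
  also have "\<dots> = (\<Sum>x\<in>vs_V m. \<Sum>w\<in>vs_star m x. (4 - 3 * t) * (u x * v x))"
    by (intro sum.cong refl) (simp add: vs_cell_equation[OF _ assms])
  also have "\<dots> = (4 - 3 * t) * (\<Sum>w\<in>vs_words m. \<Sum>x\<in>vs_cell w. u x * v x)"
    unfolding swap[symmetric] by (simp add: sum_distrib_left)
  finally show ?thesis .
qed

lemma vs_inner_cell:
  "vs_inner m u v = 1/4 * (1/5) ^ m * (\<Sum>w\<in>vs_words m. \<Sum>x\<in>vs_cell w. u x * v x)"
  by (simp only: vs_inner_def sum_vs_cell)

section \<open>Vertices of the five subcells of a cell\<close>

text \<open>A point of the square of \<open>w\<close> other than its corners lies in the square of
  no other word of that length, so only subcells of \<open>w\<close> can contain it.\<close>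

lemma vs_star_interior:
  assumes "w \<in> vs_words n" "z \<in> vs_square" "z \<notin> vs_V 0"
  shows "vs_star (Suc n) (vs_word_map w z) = (\<lambda>j. w @ [j]) ` {j \<in> {0..4}. z \<in> vs_F j ` vs_V 0}"
proof (intro set_eqI iffI)
  fix W assume "W \<in> vs_star (Suc n) (vs_word_map w z)"
  then have "W \<in> vs_words (Suc n)" and WW: "vs_word_map w z \<in> vs_cell W"
    by (simp_all add: vs_star_def)
  then obtain w' j where W: "W = w' @ [j]" "w' \<in> vs_words n" "j \<in> {0..4}"
    unfolding vs_words_Suc_snoc by auto
  obtain y where y: "y \<in> vs_V 0" "vs_word_map w z = vs_word_map w' (vs_F j y)"
    using WW unfolding W(1) vs_cell_def vs_word_map_append vs_word_map_Cons by auto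
  have "vs_F j y \<in> vs_square" using y(1) vs_V_square vs_F_square by blast
  then have "w' = w"
    using vs_word_map_overlap[OF assms(1) W(2) _ assms(2)] assms(3) y(2) by blast
  then have "z = vs_F j y" using y(2) by simp
  then show "W \<in> (\<lambda>j. w @ [j]) ` {j \<in> {0..4}. z \<in> vs_F j ` vs_V 0}"
    using W y(1) \<open>w' = w\<close> by blast
next
  fix W assume "W \<in> (\<lambda>j. w @ [j]) ` {j \<in> {0..4}. z \<in> vs_F j ` vs_V 0}"
  then obtain j y where j: "W = w @ [j]" "j \<in> {0..4}" "y \<in> vs_V 0" "z = vs_F j y" by blast
  have "vs_word_map w z = vs_word_map W y"
    by (simp add: j vs_word_map_append)
  then have "vs_word_map w z \<in> vs_cell W"
    using j(3) unfolding vs_cell_def by blast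
  then show "W \<in> vs_star (Suc n) (vs_word_map w z)"
    using assms(1) j(1,2) unfolding vs_star_def vs_words_Suc_snoc by auto
qed

text \<open>For indices 1 to 4 this is the diagonally opposite corner, as the corners are numbered
  cyclically.\<close>

definition vs_opp :: "nat \<Rightarrow> nat" where
  "vs_opp i = (if i \<le> 2 then i + 2 else i - 2)"

lemma vs_F_q_opp: "i \<in> {1..4} \<Longrightarrow> vs_F i (vs_q (vs_opp i)) = vs_F 0 (vs_q i)"
proof -
  assume "i \<in> {1..4}"
  then have "i = 1 \<or> i = 2 \<or> i = 3 \<or> i = 4" by auto
  then show ?thesis by (elim disjE) (simp_all add: vs_opp_def vs_F_def vs_q_def)
qed

lemma vs_F_q: "vs_F i (vs_q i) = vs_q i"
  by (simp add: vs_F_def scaleR_left_distrib[symmetric])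

text \<open>The new vertices of the outer subcell \<open>i\<close> are of two kinds: the junction
  with the central subcell, opposite the old corner, and two free vertices that lie in no other
  subcell.\<close>

lemma vs_F_q_in_cell:
  assumes "i \<in> {1..4}" "k \<in> {1..4}" "k \<noteq> i"
  shows "{j \<in> {0..4}. vs_F i (vs_q k) \<in> vs_F j ` vs_V 0} = (if k = vs_opp i then {0, i} else {i})"
proof -
  have set: "{1..4} = {1, 2, 3, 4::nat}" by auto
  have "vs_F i (vs_q k) \<in> vs_F j ` vs_V 0 \<longleftrightarrow> j = i \<or> j = 0 \<and> k = vs_opp i" if "j \<in> {0..4}" for j
  proof -
    have "j = 0 \<or> j = 1 \<or> j = 2 \<or> j = 3 \<or> j = 4" using that by auto
    moreover have "i = 1 \<or> i = 2 \<or> i = 3 \<or> i = 4" "k = 1 \<or> k = 2 \<or> k = 3 \<or> k = 4"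
      using assms by auto
    ultimately show ?thesis using assms(3) unfolding vs_V.simps(1) set
      by (elim disjE) (simp_all add: vs_opp_def vs_F_def vs_q_def)
  qed
  then show ?thesis using assms by auto
qed

lemma vs_F_q_not_corner:
  assumes "i \<in> {1..4}" "k \<in> {1..4}" "k \<noteq> i"
  shows "vs_F i (vs_q k) \<notin> vs_V 0"
proof -
  have set: "{1..4} = {1, 2, 3, 4::nat}" by auto
  have "i = 1 \<or> i = 2 \<or> i = 3 \<or> i = 4" "k = 1 \<or> k = 2 \<or> k = 3 \<or> k = 4"
    using assms by auto
  then show ?thesis using assms(3) unfolding vs_V.simps(1) set
    by (elim disjE) (simp_all add: vs_F_def vs_q_def)
qed

text \<open>Meant for the vertex sum of an outer subcell: old corner, junction, and two free
  vertices at which an eigenfunction takes the same value \<open>d\<close>.\<close>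

lemma sum_opp:
  fixes h :: "nat \<Rightarrow> real"
  assumes "i \<in> {1..4}" "\<And>k. k \<in> {1..4} \<Longrightarrow> k \<noteq> i \<Longrightarrow> k \<noteq> vs_opp i \<Longrightarrow> h k = d"
  shows "(\<Sum>k=1..4. h k) = h i + h (vs_opp i) + 2 * d"
proof -
  have "{1..4} = {1, 2, 3, 4::nat}" by auto
  then have "(\<Sum>k=1..4. h k) = h 1 + h 2 + h 3 + h 4" by simp
  moreover have opp: "vs_opp 1 = 3" "vs_opp 2 = 4" "vs_opp 3 = 1" "vs_opp 4 = 2"
    by (simp_all add: vs_opp_def)
  moreover have "i = 1 \<or> i = 2 \<or> i = 3 \<or> i = 4" using assms(1) by auto
  ultimately show ?thesis
    using assms(2)[of 1] assms(2)[of 2] assms(2)[of 3] assms(2)[of 4]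
    by (elim disjE) (simp_all add: opp del: One_nat_def)
qed

section \<open>Spectral decimation on one cell\<close>

text \<open>The coefficient left at the sum of the junction values once the sum of the free values
  is eliminated; its zeros are the forbidden values (7 +- sqrt 17) / 12.\<close>

definition vs_Q :: "real \<Rightarrow> real" where
  "vs_Q t = 4 - 21 * t + 18 * t ^ 2"

text \<open>Three times the denominator polynomial in \<open>vs_N\<close>; the factor 3 (1 - 2 t)
  comes from solving for a single junction value.\<close>

definition vs_P :: "real \<Rightarrow> real" where
  "vs_P t = 3 * (1 - 2 * t) * vs_Q t"

text \<open>Here \<open>a\<close>, \<open>c\<close>, \<open>d\<close> are the values at old corners,
  junctions and free vertices. Summing over \<open>i\<close> gives a closed 2 by 2 system for the
  sums of \<open>c\<close> and \<open>d\<close>; once the sum of \<open>c\<close> is known, the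
  equations for different \<open>i\<close> decouple.\<close>

lemma vs_decimation_algebra:
  fixes a c d :: "nat \<Rightarrow> real"
  assumes "t \<noteq> 4/3"
    and d: "\<And>i. i \<in> {1..4} \<Longrightarrow> a i + c i + 2 * d i = (4 - 3 * t) * d i"
    and c: "\<And>i. i \<in> {1..4} \<Longrightarrow> (\<Sum>j=1..4. c j) + (4 - 3 * t) * d i = 2 * (4 - 3 * t) * c i"
    and i: "i \<in> {1..4}"
  shows "vs_P t * c i = vs_Q t * a i + (2 - 3 * t) * (\<Sum>j=1..4. a j)"
    and "vs_P t * d i = 2 * vs_Q t * a i + (\<Sum>j=1..4. a j)"
proof -
  define A C D where "A = (\<Sum>j=1..4. a j)" and "C = (\<Sum>j=1..4. c j)" and "D = (\<Sum>j=1..4. d j)"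
  define T where "T = 4 - 3 * t"
  have T: "T \<noteq> 0" using assms(1) by (simp add: T_def field_simps)
  have "(\<Sum>i=1..4. a i + c i + 2 * d i) = (\<Sum>i=1..4. T * d i)"
    using d by (intro sum.cong refl) (simp add: T_def)
  then have 1: "A + C + 2 * D = T * D"
    unfolding A_def C_def D_def sum.distrib sum_distrib_left .
  have "(\<Sum>i=1..4. C + T * d i) = (\<Sum>i=1..4. 2 * T * c i)"
    using c by (intro sum.cong refl) (simp add: T_def C_def)
  moreover have "(\<Sum>i=1..4. C + T * d i) = 4 * C + T * D"
    unfolding D_def sum.distrib sum_distrib_left by simp
  moreover have "(\<Sum>i=1..4. 2 * T * c i) = 2 * T * C"
    unfolding C_def sum_distrib_left ..
  ultimately have 2: "4 * C + T * D = 2 * T * C" by simp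
  have QC: "vs_Q t * C = T * A"
    using 1 2 unfolding T_def vs_Q_def by algebra
  have di: "a i + c i + 2 * d i = T * d i" and ci: "C + T * d i = 2 * T * c i"
    using c[OF i] d[OF i] by (simp_all add: T_def C_def)
  \<comment> \<open>The same elimination of \<open>d i\<close> for one \<open>i\<close>, with 2 (T -
    2) - 1 = 3 (1 - 2 t).\<close>
  have "T * (3 * (1 - 2 * t) * c i) = (2 - 3 * t) * C + T * a i"
    using di ci unfolding T_def by algebra
  then have "T * (vs_P t * c i) = T * (vs_Q t * a i + (2 - 3 * t) * A)"
    using QC unfolding vs_P_def by algebra
  then have Pc: "vs_P t * c i = vs_Q t * a i + (2 - 3 * t) * A"
    using T by simp
  then show "vs_P t * c i = vs_Q t * a i + (2 - 3 * t) * (\<Sum>j=1..4. a j)"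
    by (simp add: A_def)
  have "T * (vs_P t * d i) = T * (2 * vs_Q t * a i + A)"
    using Pc ci QC unfolding vs_P_def by algebra
  then show "vs_P t * d i = 2 * vs_Q t * a i + (\<Sum>j=1..4. a j)"
    using T by (simp add: A_def)
qed

text \<open>The weight 2 on \<open>c\<close> counts a junction in both the outer and the central
  subcell; the weight 2 on \<open>d\<close> counts two free vertices. Summed over \<open>i\<close>,
  the cross terms collapse to the product of the two corner sums.\<close>

lemma vs_decimation_inner_algebra:
  fixes a c d a' c' d' :: "nat \<Rightarrow> real"
  assumes "\<And>i. i \<in> {1..4} \<Longrightarrow> P * c i = Q * a i + r * (\<Sum>j=1..4. a j)"
    and "\<And>i. i \<in> {1..4} \<Longrightarrow> P * d i = 2 * Q * a i + (\<Sum>j=1..4. a j)"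
    and "\<And>i. i \<in> {1..4} \<Longrightarrow> P * c' i = Q * a' i + r * (\<Sum>j=1..4. a' j)"
    and "\<And>i. i \<in> {1..4} \<Longrightarrow> P * d' i = 2 * Q * a' i + (\<Sum>j=1..4. a' j)"
  shows "P\<^sup>2 * (\<Sum>i=1..4. a i * a' i + 2 * (c i * c' i) + 2 * (d i * d' i))
    = (P\<^sup>2 + 10 * Q\<^sup>2) * (\<Sum>i=1..4. a i * a' i)
      + (4 * Q * r + 8 * r\<^sup>2 + 8 * Q + 8) * ((\<Sum>i=1..4. a i) * (\<Sum>i=1..4. a' i))"
proof -
  define A A' where "A = (\<Sum>j=1..4. a j)" and "A' = (\<Sum>j=1..4. a' j)"
  have "P\<^sup>2 * (\<Sum>i=1..4. a i * a' i + 2 * (c i * c' i) + 2 * (d i * d' i))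
    = (\<Sum>i=1..4. P\<^sup>2 * (a i * a' i) + 2 * ((P * c i) * (P * c' i)) + 2 * ((P * d i) * (P * d' i)))"
    unfolding sum_distrib_left by (intro sum.cong refl) algebra
  also have "\<dots> = (\<Sum>i=1..4. (P\<^sup>2 + 10 * Q\<^sup>2) * (a i * a' i) + (2 * Q * r + 4 * Q) * A' * a i
      + (2 * Q * r + 4 * Q) * A * a' i + (2 * r\<^sup>2 + 2) * (A * A'))"
  proof (intro sum.cong refl)
    fix i assume i: "i \<in> {1..4::nat}"
    note eqs = assms[OF i, folded A_def A'_def]
    show "P\<^sup>2 * (a i * a' i) + 2 * ((P * c i) * (P * c' i)) + 2 * ((P * d i) * (P * d' i))
      = (P\<^sup>2 + 10 * Q\<^sup>2) * (a i * a' i) + (2 * Q * r + 4 * Q) * A' * a i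
        + (2 * Q * r + 4 * Q) * A * a' i + (2 * r\<^sup>2 + 2) * (A * A')"
      unfolding eqs by algebra
  qed
  also have "\<dots> = (P\<^sup>2 + 10 * Q\<^sup>2) * (\<Sum>i=1..4. a i * a' i)
      + (4 * Q * r + 8 * r\<^sup>2 + 8 * Q + 8) * (A * A')"
    unfolding sum.distrib sum_distrib_left[symmetric] A_def[symmetric] A'_def[symmetric]
    by (simp add: algebra_simps)
  finally show ?thesis by (simp add: A_def A'_def)
qed

text \<open>The eigenvalue equations at the twelve new vertices of the cell are brought into the
  form of \<open>vs_decimation_algebra\<close>.\<close>

lemma vs_decimation_cell:
  assumes "\<And>x. x \<in> vs_V (Suc n) \<Longrightarrow> - vs_laplacian (Suc n) u x = t * u x"
    and t: "t \<noteq> 4/3" and w: "w \<in> vs_words n" and i: "i \<in> {1..4}"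
  shows "vs_P t * u (vs_word_map w (vs_F i (vs_q (vs_opp i))))
      = vs_Q t * u (vs_word_map w (vs_q i)) + (2 - 3 * t) * vs_csum u w"
    and "k \<in> {1..4} \<Longrightarrow> k \<noteq> i \<Longrightarrow> k \<noteq> vs_opp i \<Longrightarrow>
      vs_P t * u (vs_word_map w (vs_F i (vs_q k)))
      = 2 * vs_Q t * u (vs_word_map w (vs_q i)) + vs_csum u w"
proof -
  define g where "g z = u (vs_word_map w z)" for z
  define T where "T = 4 - 3 * t"
  have T: "T \<noteq> 0" using t by (simp add: T_def field_simps)
  define S where "S j = vs_csum u (w @ [j])" for j
  have S: "S j = (\<Sum>k=1..4. g (vs_F j (vs_q k)))" for j
    unfolding S_def vs_csum_def sum_vs_cell g_def by (simp only: vs_word_map_append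
        vs_word_map_Cons vs_word_map_Nil id_apply)
  \<comment> \<open>The eigenvalue equation at a new vertex: two subcells meet at a junction, while
    a free vertex lies in one.\<close>
  have eq: "(\<Sum>j\<in>(if k = vs_opp i then {0, i} else {i}). S j)
      = real (card (if k = vs_opp i then {0, i} else {i})) * T * g (vs_F i (vs_q k))"
    if ik: "i \<in> {1..4}" "k \<in> {1..4}" "k \<noteq> i" for i k
  proof -
    define J where "J = (if k = vs_opp i then {0, i} else {i})"
    have z: "vs_F i (vs_q k) \<in> vs_square" using vs_q_square vs_F_square by blast
    have star: "vs_star (Suc n) (vs_word_map w (vs_F i (vs_q k))) = (\<lambda>j. w @ [j]) ` J"
      using vs_star_interior[OF w z vs_F_q_not_corner[OF ik]] vs_F_q_in_cell[OF ik]
      by (simp add: J_def)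
    have "J \<noteq> {}" by (simp add: J_def)
    then have "vs_star (Suc n) (vs_word_map w (vs_F i (vs_q k))) \<noteq> {}" using star by blast
    then have x: "vs_word_map w (vs_F i (vs_q k)) \<in> vs_V (Suc n)"
      unfolding vs_V_eq_UN_cell vs_star_def by blast
    have inj: "inj_on (\<lambda>j. w @ [j]) J" by (simp add: inj_on_def)
    show ?thesis
      using vs_cell_equation[OF x assms(1)[OF x]]
      unfolding star J_def[symmetric]
      by (simp add: sum.reindex[OF inj] card_image[OF inj] S_def g_def T_def)
  qed
  \<comment> \<open>At a free vertex the equation says that \<open>S j\<close> is \<open>T\<close>
    times the value there, so both free vertices of subcell \<open>j\<close> carry the value
    \<open>S j / T\<close>.\<close>
  define a c d where "a j = g (vs_q j)" and "c j = g (vs_F j (vs_q (vs_opp j)))" and "d j = S j / T" for j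
  have opp: "vs_opp j \<in> {1..4}" "vs_opp j \<noteq> j" "j \<noteq> 0" if "j \<in> {1..4}" for j
    using that by (auto simp: vs_opp_def)
  have d: "g (vs_F j (vs_q k)) = d j" if "j \<in> {1..4}" "k \<in> {1..4}" "k \<noteq> j" "k \<noteq> vs_opp j" for j k
    using eq[OF that(1-3)] that(4) T by (simp add: d_def field_simps)
  have "a j + c j + 2 * d j = (4 - 3 * t) * d j" if j: "j \<in> {1..4}" for j
  proof -
    have "S j = g (vs_F j (vs_q j)) + c j + 2 * d j"
      unfolding S c_def using sum_opp[OF j, of "\<lambda>k. g (vs_F j (vs_q k))"] d[OF j] by blast
    then show ?thesis using T by (simp add: vs_F_q a_def d_def T_def[symmetric])
  qed
  moreover have "(\<Sum>j=1..4. c j) + (4 - 3 * t) * d j = 2 * (4 - 3 * t) * c j"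
    if j: "j \<in> {1..4}" for j
  proof -
    have "S 0 = (\<Sum>j=1..4. c j)"
      unfolding S c_def by (intro sum.cong refl) (simp only: vs_F_q_opp)
    moreover have "(4 - 3 * t) * d j = S j" using T by (simp add: d_def T_def)
    moreover have "S 0 + S j = 2 * T * c j"
      using eq[OF j opp(1,2)[OF j]] opp(3)[OF j] by (simp add: c_def)
    ultimately show ?thesis by (simp add: T_def)
  qed
  ultimately have *: "vs_P t * c i = vs_Q t * a i + (2 - 3 * t) * (\<Sum>j=1..4. a j)"
    "vs_P t * d i = 2 * vs_Q t * a i + (\<Sum>j=1..4. a j)"
    using vs_decimation_algebra[OF t _ _ i, of a c d] by blast+
  moreover have "(\<Sum>j=1..4. a j) = vs_csum u w"
    unfolding a_def g_def vs_csum_def sum_vs_cell ..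
  ultimately show "vs_P t * u (vs_word_map w (vs_F i (vs_q (vs_opp i))))
      = vs_Q t * u (vs_word_map w (vs_q i)) + (2 - 3 * t) * vs_csum u w"
    by (simp add: a_def c_def g_def)
  show "vs_P t * u (vs_word_map w (vs_F i (vs_q k)))
      = 2 * vs_Q t * u (vs_word_map w (vs_q i)) + vs_csum u w"
    if "k \<in> {1..4}" "k \<noteq> i" "k \<noteq> vs_opp i"
    using *(2) d[OF i that] \<open>(\<Sum>j=1..4. a j) = vs_csum u w\<close> by (simp add: a_def g_def)
qed

lemma vs_cell_sum_refine:
  assumes w: "w \<in> vs_words n" and t: "t \<noteq> 4/3" "vs_P t \<noteq> 0"
    and u: "\<And>x. x \<in> vs_V (Suc n) \<Longrightarrow> - vs_laplacian (Suc n) u x = t * u x"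
    and v: "\<And>x. x \<in> vs_V (Suc n) \<Longrightarrow> - vs_laplacian (Suc n) v x = t * v x"
  shows "(vs_P t)\<^sup>2 * (\<Sum>i\<in>{0..4}. \<Sum>x\<in>vs_cell (w @ [i]). u x * v x)
    = ((vs_P t)\<^sup>2 + 10 * (vs_Q t)\<^sup>2) * (\<Sum>x\<in>vs_cell w. u x * v x)
      + (4 * vs_Q t * (2 - 3 * t) + 8 * (2 - 3 * t)\<^sup>2 + 8 * vs_Q t + 8)
        * (vs_csum u w * vs_csum v w)"
proof -
  define c where "c f i = f (vs_word_map w (vs_F i (vs_q (vs_opp i))))" for f :: "real \<times> real \<Rightarrow> real" and i
  define a where "a f i = f (vs_word_map w (vs_q i))" for f :: "real \<times> real \<Rightarrow> real" and i
  define d where "d f i = (2 * vs_Q t * a f i + vs_csum f w) / vs_P t" for f i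
  have csum: "vs_csum f w = (\<Sum>j=1..4. a f j)" for f
    unfolding a_def vs_csum_def sum_vs_cell ..
  have cell: "(\<Sum>x\<in>vs_cell (w @ [i]). f x) = (\<Sum>k=1..4. f (vs_word_map w (vs_F i (vs_q k))))"
    for f :: "real \<times> real \<Rightarrow> real" and i
    unfolding sum_vs_cell by (simp only: vs_word_map_append vs_word_map_Cons vs_word_map_Nil id_apply)
  have corner: "(\<Sum>x\<in>vs_cell (w @ [i]). u x * v x)
      = a u i * a v i + c u i * c v i + 2 * (d u i * d v i)" if i: "i \<in> {1..4}" for i
  proof -
    have prod: "u (vs_word_map w (vs_F i (vs_q k))) * v (vs_word_map w (vs_F i (vs_q k))) = d u i * d v i"
      if k: "k \<in> {1..4}" "k \<noteq> i" "k \<noteq> vs_opp i" for k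
    proof -
      have "u (vs_word_map w (vs_F i (vs_q k))) = d u i"
        using vs_decimation_cell(2)[OF u t(1) w i k] t(2) by (simp add: d_def a_def field_simps)
      moreover have "v (vs_word_map w (vs_F i (vs_q k))) = d v i"
        using vs_decimation_cell(2)[OF v t(1) w i k] t(2) by (simp add: d_def a_def field_simps)
      ultimately show ?thesis by simp
    qed
    show ?thesis
      unfolding cell by (subst sum_opp[OF i prod]) (simp_all add: a_def c_def vs_F_q)
  qed
  have center: "(\<Sum>x\<in>vs_cell (w @ [0]). u x * v x) = (\<Sum>i=1..4. c u i * c v i)"
    unfolding cell by (intro sum.cong refl) (simp only: c_def vs_F_q_opp)
  have "{0..4} = insert 0 {1..4::nat}" by auto
  then have "(\<Sum>i\<in>{0..4}. \<Sum>x\<in>vs_cell (w @ [i]). u x * v x)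
      = (\<Sum>x\<in>vs_cell (w @ [0]). u x * v x) + (\<Sum>i=1..4. \<Sum>x\<in>vs_cell (w @ [i]). u x * v x)"
    by (simp only: sum.insert_if finite_atLeastAtMost) simp
  also have "\<dots> = (\<Sum>i=1..4. c u i * c v i)
      + (\<Sum>i=1..4. a u i * a v i + c u i * c v i + 2 * (d u i * d v i))"
    using corner by (simp only: center cong: sum.cong)
  also have "\<dots> = (\<Sum>i=1..4. a u i * a v i + 2 * (c u i * c v i) + 2 * (d u i * d v i))"
    unfolding sum.distrib[symmetric] by (intro sum.cong refl) simp
  finally have *: "(\<Sum>i\<in>{0..4}. \<Sum>x\<in>vs_cell (w @ [i]). u x * v x)
      = (\<Sum>i=1..4. a u i * a v i + 2 * (c u i * c v i) + 2 * (d u i * d v i))" .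
  have "vs_P t * c u i = vs_Q t * a u i + (2 - 3 * t) * (\<Sum>j=1..4. a u j)"
    "vs_P t * c v i = vs_Q t * a v i + (2 - 3 * t) * (\<Sum>j=1..4. a v j)" if "i \<in> {1..4}" for i
    using vs_decimation_cell(1)[OF u t(1) w that] vs_decimation_cell(1)[OF v t(1) w that]
    unfolding csum[symmetric] by (simp_all add: c_def a_def)
  moreover have "vs_P t * d u i = 2 * vs_Q t * a u i + (\<Sum>j=1..4. a u j)"
    "vs_P t * d v i = 2 * vs_Q t * a v i + (\<Sum>j=1..4. a v j)" for i
    unfolding csum[symmetric] using t(2) by (simp_all add: d_def)
  moreover have "(\<Sum>x\<in>vs_cell w. u x * v x) = (\<Sum>i=1..4. a u i * a v i)"
    unfolding sum_vs_cell a_def ..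
  ultimately show ?thesis
    unfolding * csum using vs_decimation_inner_algebra[of "vs_P t" "c u" "vs_Q t" "a u" "2 - 3 * t" "d u" "c v" "a v" "d v"]
    by simp
qed

section \<open>The recursion for the graph inner products\<close>

lemma vs_denominator: "3 * (4 - 29 * t + 60 * t ^ 2 - 36 * t ^ 3) = vs_P t"
  unfolding vs_P_def vs_Q_def by algebra

text \<open>Besides 1/2 the roots of \<open>vs_P\<close> are those of \<open>vs_Q\<close>, found by
  completing the square.\<close>

lemma vs_P_nonzero:
  assumes "t \<notin> vs_forbidden"
  shows "vs_P t \<noteq> 0"
proof -
  have s: "sqrt 17 ^ 2 = 17" by simp
  have "72 * vs_Q t = (36 * t - 21)\<^sup>2 - 9 * (sqrt 17)\<^sup>2"
    unfolding vs_Q_def s by algebra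
  also have "\<dots> = (36 * t - 21 - 3 * sqrt 17) * (36 * t - 21 + 3 * sqrt 17)" by algebra
  also have "\<dots> \<noteq> 0"
  proof -
    have "36 * t - 21 - 3 * sqrt 17 \<noteq> 0" "36 * t - 21 + 3 * sqrt 17 \<noteq> 0"
      using assms by (auto simp: vs_forbidden_def field_simps)
    then show ?thesis by simp
  qed
  finally show ?thesis using assms by (auto simp: vs_P_def vs_forbidden_def)
qed

text \<open>Summing \<open>vs_cell_sum_refine\<close> over all cells leaves a multiple of the
  products of cell sums; the eigenvalue equation on level \<open>n\<close>, with eigenvalue
  \<open>vs_R t\<close>, turns it into a multiple of \<open>X\<close>.\<close>

lemma vs_inner_Suc:
  assumes t: "t \<notin> vs_forbidden"
    and u: "\<And>x. x \<in> vs_V (Suc n) \<Longrightarrow> - vs_laplacian (Suc n) u x = t * u x"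
    and v: "\<And>x. x \<in> vs_V (Suc n) \<Longrightarrow> - vs_laplacian (Suc n) v x = t * v x"
    and v': "\<And>x. x \<in> vs_V n \<Longrightarrow> - vs_laplacian n v x = vs_R t * v x"
  shows "vs_inner (Suc n) u v = vs_N t * vs_inner n u v"
proof -
  define X where "X = (\<Sum>w\<in>vs_words n. \<Sum>x\<in>vs_cell w. u x * v x)"
  define Y where "Y = (\<Sum>w\<in>vs_words (Suc n). \<Sum>x\<in>vs_cell w. u x * v x)"
  define num where "num = 20 - 143 * t + 240 * t ^ 2 - 108 * t ^ 3"
  have t': "t \<noteq> 4/3" using t by (auto simp: vs_forbidden_def)
  note P = vs_P_nonzero[OF t]
  have "(vs_P t)\<^sup>2 * Y = ((vs_P t)\<^sup>2 + 10 * (vs_Q t)\<^sup>2) * X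
      + (4 * vs_Q t * (2 - 3 * t) + 8 * (2 - 3 * t)\<^sup>2 + 8 * vs_Q t + 8)
        * (\<Sum>w\<in>vs_words n. vs_csum u w * vs_csum v w)"
    unfolding X_def Y_def sum_vs_words_Suc_snoc sum_distrib_left[of _ _ "vs_words n"]
      sum.distrib[symmetric]
    using vs_cell_sum_refine[OF _ t' P u v] by (intro sum.cong refl) simp
  also have "(\<Sum>w\<in>vs_words n. vs_csum u w * vs_csum v w) = (4 - 3 * vs_R t) * X"
    unfolding X_def by (rule sum_vs_csum_mult[OF v'])
  \<comment> \<open>The polynomial identity behind \<open>vs_N\<close>: the coefficient of
    \<open>X\<close> is divisible by \<open>vs_P t\<close>, so one factor cancels
    afterwards.\<close>
  also have "((vs_P t)\<^sup>2 + 10 * (vs_Q t)\<^sup>2) * X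
      + (4 * vs_Q t * (2 - 3 * t) + 8 * (2 - 3 * t)\<^sup>2 + 8 * vs_Q t + 8) * ((4 - 3 * vs_R t) * X)
    = 3 * vs_P t * num * X"
    unfolding vs_P_def vs_R_def num_def vs_Q_def by algebra
  finally have "vs_P t * (vs_P t * Y) = vs_P t * (3 * num * X)"
    by (simp add: power2_eq_square mult_ac)
  then have "vs_P t * Y = 3 * num * X" using P by simp
  then have "Y = num / (4 - 29 * t + 60 * t ^ 2 - 36 * t ^ 3) * X"
    using P unfolding vs_denominator[symmetric] by (simp add: field_simps)
  then show ?thesis
    unfolding vs_inner_cell vs_N_def X_def[symmetric] Y_def[symmetric] num_def[symmetric]
    by simp
qed

lemma vs_eigenfunction_inner:
  assumes "m' < m" "vs_eigenfunction m' u lam" "vs_eigenfunction m' v lam'"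
    and "lam (m - 1) = lam' (m - 1)" "lam m = lam' m"
  shows "vs_inner m u v = vs_N (lam m) * vs_inner (m - 1) u v"
proof -
  obtain n where n: "m = Suc n" using assms(1) by (cases m) auto
  have "lam' (m - 1) = vs_R (lam' m)" "lam' m \<notin> vs_forbidden"
    using assms(1,3) unfolding vs_eigenfunction_def by blast+
  then show ?thesis
    using assms vs_inner_Suc[of "lam m" n u v] unfolding n vs_eigenfunction_def by simp
qed

section \<open>Graph eigenvalues\<close>

text \<open>Outside the interval from 0 to 4/3 the product t (3 t - 4) is positive, so R(t) / t
  exceeds 15: R is negative to the left and above 20 to the right.\<close>

lemma vs_R_bounds_imp:
  assumes "0 \<le> vs_R t" "vs_R t \<le> 4/3"
  shows "0 \<le> t" "t \<le> 4/3"
proof -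
  have R: "vs_R t = t * (12 * t * (3 * t - 4) + 15)"
    unfolding vs_R_def by algebra
  show "0 \<le> t"
  proof (rule ccontr)
    assume "\<not> 0 \<le> t"
    then have "0 < 12 * t * (3 * t - 4)" by (intro mult_neg_neg) auto
    then have "t * (12 * t * (3 * t - 4) + 15) < 0" using \<open>\<not> 0 \<le> t\<close> by (intro mult_neg_pos) auto
    then show False using assms R by simp
  qed
  show "t \<le> 4/3"
  proof (rule ccontr)
    assume "\<not> t \<le> 4/3"
    then have "0 < 12 * t * (3 * t - 4)" by (intro mult_pos_pos) auto
    then have "4/3 * 15 < t * (12 * t * (3 * t - 4) + 15)"
      using \<open>\<not> t \<le> 4/3\<close> by (intro mult_strict_mono) auto
    then show False using assms R by simp
  qed
qed

text \<open>R(0) = 0 and R(1/6) = 4/3, so the intermediate value theorem applies; it makes the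
  smallest root at most 1/6.\<close>

lemma vs_R_root:
  assumes "0 \<le> s" "s \<le> 4/3"
  shows "\<exists>t\<le>1/6. vs_R t = s"
proof -
  have "\<exists>t\<ge>0. t \<le> 1/6 \<and> vs_R t = s"
  proof (rule IVT')
    show "vs_R 0 \<le> s" "s \<le> vs_R (1/6)"
      using assms by (simp_all add: vs_R_def power3_eq_cube power2_eq_square)
    show "continuous_on {0..1/6} vs_R" unfolding vs_R_def by (intro continuous_intros)
  qed simp
  then show ?thesis by blast
qed

text \<open>The slope 8 is that of the chord of R between 0 and 1/6.\<close>

lemma vs_R_ge: "0 \<le> t \<Longrightarrow> t \<le> 1/6 \<Longrightarrow> 8 * t \<le> vs_R t"
proof -
  assume t: "0 \<le> t" "t \<le> 1/6"
  have "0 \<le> t * ((1 - 6 * t) * (7 - 6 * t))"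
    using t by (intro mult_nonneg_nonneg) auto
  also have "\<dots> = vs_R t - 8 * t" unfolding vs_R_def by algebra
  finally show ?thesis by simp
qed

text \<open>The slope 15 is the derivative of R at 0.\<close>

lemma vs_R_le: "0 \<le> t \<Longrightarrow> t \<le> 1/6 \<Longrightarrow> vs_R t \<le> 15 * t"
proof -
  assume t: "0 \<le> t" "t \<le> 1/6"
  have "0 \<le> t * (12 * t * (4 - 3 * t))"
    using t by (intro mult_nonneg_nonneg) auto
  also have "\<dots> = 15 * t - vs_R t" unfolding vs_R_def by algebra
  finally show ?thesis by simp
qed

text \<open>The factor \<open>1 + t\<close> compensates the term -48 t^2 of R: by
  \<open>vs_R_ge\<close> the square of \<open>vs_R t\<close> contributes at least 64 t^2, and 64 -
  48 is at least 15.\<close>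

lemma vs_R_lyapunov:
  assumes "0 \<le> t" "t \<le> 1/6"
  shows "15 * (t * (1 + t)) \<le> vs_R t * (1 + vs_R t)"
proof -
  have "(8 * t)\<^sup>2 \<le> (vs_R t)\<^sup>2"
    using vs_R_ge[OF assms] assms by (intro power_mono) auto
  moreover have "0 \<le> t\<^sup>2 + 36 * t ^ 3" using assms by simp
  moreover have "vs_R t + (8 * t)\<^sup>2 = 15 * (t * (1 + t)) + (t\<^sup>2 + 36 * t ^ 3)"
    unfolding vs_R_def by algebra
  ultimately show ?thesis by (simp add: algebra_simps power2_eq_square)
qed

text \<open>The divided difference \<open>k\<close> of R stays between -15 and 15. The constant
  matches the renormalisation factor, which makes the gap in \<open>vs_eigenvalue_inj\<close>
  nondecreasing.\<close>

lemma vs_R_lipschitz: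
  assumes "0 \<le> s" "s \<le> 1/6" "0 \<le> t" "t \<le> 1/6"
  shows "\<bar>vs_R s - vs_R t\<bar> \<le> 15 * \<bar>s - t\<bar>"
proof -
  define p where "p = s\<^sup>2 + s * t + t\<^sup>2"
  define k where "k = 36 * p - 48 * (s + t) + 15"
  have "(s + t) * (s + t) \<le> 1/3 * (s + t)" using assms by (intro mult_right_mono) auto
  moreover have "0 \<le> s * t" using assms by simp
  ultimately have "36 * p \<le> 12 * (s + t)"
    by (simp add: p_def algebra_simps power2_eq_square)
  moreover have "12 * (s + t) \<le> 48 * (s + t)" using assms by simp
  ultimately have "k \<le> 15" unfolding k_def by simp
  have "0 \<le> p" using assms by (simp add: p_def)
  moreover have "48 * (s + t) \<le> 16" using assms by simp
  ultimately have "-15 \<le> k" unfolding k_def by simp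
  with \<open>k \<le> 15\<close> have "\<bar>k\<bar> \<le> 15" by simp
  have "vs_R s - vs_R t = k * (s - t)" unfolding k_def p_def vs_R_def by algebra
  then have "\<bar>vs_R s - vs_R t\<bar> = \<bar>k\<bar> * \<bar>s - t\<bar>" by (simp add: abs_mult)
  also have "\<dots> \<le> 15 * \<bar>s - t\<bar>" using \<open>\<bar>k\<bar> \<le> 15\<close> by (intro mult_right_mono) auto
  finally show ?thesis .
qed

section \<open>Graph eigenvalues of eigenfunctions born on level 0\<close>

lemma vs_eigenfunction_R:
  "vs_eigenfunction 0 u lam \<Longrightarrow> lam m = vs_R (lam (Suc m))"
  unfolding vs_eigenfunction_def by (metis diff_Suc_1 zero_less_Suc)

lemma vs_graph_eigenvalue_bounds:
  assumes "vs_eigenfunction 0 u lam"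
  shows "0 \<le> lam m \<and> lam m \<le> 4/3"
proof (induction m)
  case 0
  then show ?case using assms by (auto simp: vs_eigenfunction_def)
next
  case (Suc m)
  then show ?case using vs_R_bounds_imp[of "lam (Suc m)"] vs_eigenfunction_R[OF assms, of m] by simp
qed

text \<open>Eventually \<open>lam m\<close> is the smallest root, hence at most the root supplied by
  \<open>vs_R_root\<close>.\<close>

lemma vs_graph_eigenvalue_eventually_small:
  assumes "vs_eigenfunction 0 u lam"
  shows "\<exists>M. \<forall>m\<ge>M. 0 \<le> lam m \<and> lam m \<le> 1/6"
proof -
  have "\<forall>\<^sub>F m in sequentially. \<forall>t. vs_R t = lam (m - 1) \<longrightarrow> lam m \<le> t"
    using assms unfolding vs_eigenfunction_def by (auto elim: eventually_mono)
  then obtain M where M: "\<And>m t. m \<ge> M \<Longrightarrow> vs_R t = lam (m - 1) \<Longrightarrow> lam m \<le> t"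
    unfolding eventually_sequentially by blast
  have "lam m \<le> 1/6" if "m \<ge> M" for m
    using vs_R_root[of "lam (m - 1)"] vs_graph_eigenvalue_bounds[OF assms, of "m - 1"] M[OF that]
    by force
  then show ?thesis using vs_graph_eigenvalue_bounds[OF assms] by blast
qed

text \<open>The sequence \<open>15 ^ m * lam m\<close> increases, since \<open>R t \<le> 15 t\<close>; it is bounded because
  \<open>15 ^ m * lam m * (1 + lam m)\<close> decreases.\<close>

lemma vs_eigenvalue_LIMSEQ:
  assumes "vs_eigenfunction 0 u lam"
  shows "(\<lambda>m. 15 ^ m * lam m) \<longlonglongrightarrow> vs_eigenvalue lam"
proof -
  obtain M where M: "\<And>m. m \<ge> M \<Longrightarrow> 0 \<le> lam m" "\<And>m. m \<ge> M \<Longrightarrow> lam m \<le> 1/6"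
    using vs_graph_eigenvalue_eventually_small[OF assms] by blast
  define x where "x m = 15 ^ (m + M) * lam (m + M)" for m
  define y where "y m = 15 ^ (m + M) * (lam (m + M) * (1 + lam (m + M)))" for m
  have R: "lam (m + M) = vs_R (lam (Suc m + M))" for m
    using vs_eigenfunction_R[OF assms, of "m + M"] by simp
  have "incseq x"
  proof (rule incseq_SucI)
    fix m
    have "lam (m + M) \<le> 15 * lam (Suc m + M)"
      unfolding R[of m] by (intro vs_R_le M) auto
    then show "x m \<le> x (Suc m)" by (simp add: x_def)
  qed
  moreover have "decseq y"
  proof (rule decseq_SucI)
    fix m
    have "15 * (lam (Suc m + M) * (1 + lam (Suc m + M))) \<le> lam (m + M) * (1 + lam (m + M))"
      unfolding R[of m] by (intro vs_R_lyapunov M) auto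
    then show "y (Suc m) \<le> y m" by (simp add: y_def)
  qed
  then have "y m \<le> y 0" for m by (simp add: decseqD)
  moreover have "x m \<le> y m" for m
    using M(1)[of "m + M"] unfolding x_def y_def by (simp add: mult_left_mono algebra_simps)
  ultimately have "convergent x"
    by (metis incseq_convergent order_trans convergent_def)
  then have "convergent (\<lambda>m. 15 ^ m * lam m)"
    unfolding x_def by (simp only: convergent_ignore_initial_segment[where f = "\<lambda>m. 15 ^ m * lam m"])
  then show ?thesis by (simp add: vs_eigenvalue_def convergent_LIMSEQ_iff)
qed

lemma vs_eigenvalue_inj:
  assumes u: "vs_eigenfunction 0 u lam" and v: "vs_eigenfunction 0 v lam'"
    and eq: "vs_eigenvalue lam = vs_eigenvalue lam'"
  shows "lam = lam'"
proof -
  obtain M where M: "\<And>m. m \<ge> M \<Longrightarrow> 0 \<le> lam m \<and> lam m \<le> 1/6"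
    using vs_graph_eigenvalue_eventually_small[OF u] by blast
  obtain M' where M': "\<And>m. m \<ge> M' \<Longrightarrow> 0 \<le> lam' m \<and> lam' m \<le> 1/6"
    using vs_graph_eigenvalue_eventually_small[OF v] by blast
  define K where "K = max M M'"
  define x where "x m = \<bar>15 ^ (m + K) * lam (m + K) - 15 ^ (m + K) * lam' (m + K)\<bar>" for m
  have "(\<lambda>m. \<bar>15 ^ m * lam m - 15 ^ m * lam' m\<bar>) \<longlonglongrightarrow> \<bar>vs_eigenvalue lam - vs_eigenvalue lam'\<bar>"
    by (intro tendsto_intros vs_eigenvalue_LIMSEQ[OF u] vs_eigenvalue_LIMSEQ[OF v])
  then have "x \<longlonglongrightarrow> 0"
    unfolding x_def eq using LIMSEQ_ignore_initial_segment by fastforce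
  moreover have "incseq x"
  proof (rule incseq_SucI)
    fix m
    have x: "x m = 15 ^ (m + K) * \<bar>lam (m + K) - lam' (m + K)\<bar>" for m
      unfolding x_def by (simp add: abs_mult flip: right_diff_distrib)
    have "\<bar>lam (m + K) - lam' (m + K)\<bar> \<le> 15 * \<bar>lam (Suc m + K) - lam' (Suc m + K)\<bar>"
      using vs_R_lipschitz[of "lam (Suc m + K)" "lam' (Suc m + K)"]
        M[of "Suc m + K"] M'[of "Suc m + K"] vs_eigenfunction_R[OF u, of "m + K"]
        vs_eigenfunction_R[OF v, of "m + K"]
      by (simp add: K_def)
    then show "x m \<le> x (Suc m)" unfolding x by simp
  qed
  \<comment> \<open>A nondecreasing sequence stays below its limit, here 0, so the nonnegative gaps
    vanish.\<close>
  ultimately have "x m \<le> 0" for m by (rule incseq_le[rotated])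
  then have tail: "lam (m + K) = lam' (m + K)" for m
    using abs_le_zero_iff unfolding x_def by fastforce
  \<comment> \<open>Below \<open>K\<close> each value is \<open>vs_R\<close> of the next, so
    equality passes downwards; truncated subtraction makes the steps with \<open>j \<ge> K\<close>
    trivial.\<close>
  have "lam (K - j) = lam' (K - j)" for j
  proof (induction j)
    case (Suc j)
    show ?case
    proof (cases "j < K")
      case True
      then have "Suc (K - Suc j) = K - j" by simp
      then show ?thesis
        using Suc vs_eigenfunction_R[OF u, of "K - Suc j"] vs_eigenfunction_R[OF v, of "K - Suc j"]
        by simp
    qed (use Suc in simp)
  qed (use tail[of 0] in simp)
  then have "lam m = lam' m" for m
    using tail[of "m - K"] \<open>\<And>j. lam (K - j) = lam' (K - j)\<close>[of "K - m"]
    by (cases "K \<le> m") simp_all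
  then show ?thesis by blast
qed

section \<open>Convergence of the product\<close>

lemma vs_N_minus_1_bound:
  assumes "0 \<le> t" "t \<le> 1/6"
  shows "\<bar>vs_N t - 1\<bar> \<le> 5 * t"
proof -
  define D where "D = 4 - 29 * t + 60 * t ^ 2 - 36 * t ^ 3"
  \<comment> \<open>This product is the quadratic factor of \<open>D\<close> minus 1; together with
    \<open>1 - 2 * t \<ge> 2/3\<close> it bounds \<open>D\<close> from below.\<close>
  have "0 \<le> 3 * (1 - 6 * t) * (1 - t)" using assms by (intro mult_nonneg_nonneg) auto
  then have "1 \<le> 4 - 21 * t + 18 * t\<^sup>2" by (simp add: algebra_simps power2_eq_square)
  then have "2/3 * 1 \<le> (1 - 2 * t) * (4 - 21 * t + 18 * t\<^sup>2)"
    using assms by (intro mult_mono) auto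
  also have "\<dots> = D" unfolding D_def by algebra
  finally have D: "2/3 \<le> D" by simp
  have "5 * D * (vs_N t - 1) = 20 - 143 * t + 240 * t ^ 2 - 108 * t ^ 3 - 5 * D"
    using D unfolding vs_N_def D_def[symmetric] by (simp add: field_simps)
  \<comment> \<open>Both polynomials have constant term 20, so the difference contains the factor
    \<open>t\<close>.\<close>
  also have "\<dots> = t * (2 - 60 * t + 72 * t\<^sup>2)" unfolding D_def by algebra
  finally have *: "5 * D * (vs_N t - 1) = t * (2 - 60 * t + 72 * t\<^sup>2)" .
  have "t * t \<le> 1/6 * (1/6)" using assms by (intro mult_mono) auto
  moreover have "0 \<le> t * t" by simp
  ultimately have "\<bar>2 - 60 * t + 72 * t\<^sup>2\<bar> \<le> 10"
    using assms unfolding abs_le_iff power2_eq_square by linarith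
  then have "\<bar>t * (2 - 60 * t + 72 * t\<^sup>2)\<bar> \<le> t * 10"
    using assms by (simp add: abs_mult mult_left_mono)
  then have "5 * D * \<bar>vs_N t - 1\<bar> \<le> 10 * t"
    unfolding *[symmetric] using D by (simp add: abs_mult)
  moreover have "2 * \<bar>vs_N t - 1\<bar> \<le> 5 * D * \<bar>vs_N t - 1\<bar>"
    using D by (intro mult_right_mono) auto
  ultimately have "2 * \<bar>vs_N t - 1\<bar> \<le> 10 * t" by (rule order_trans[rotated])
  then show ?thesis by simp
qed

text \<open>By \<open>vs_R_ge\<close> the graph eigenvalues eventually shrink by a factor 8 per
  step, so they are summable, and \<open>vs_N_minus_1_bound\<close> carries this over to the factors
  minus 1.\<close>

lemma convergent_prod_vs_N:
  assumes "vs_eigenfunction 0 u lam"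
  shows "convergent_prod (\<lambda>n. vs_N (lam (Suc n)))"
proof -
  obtain M where M: "\<And>m. m \<ge> M \<Longrightarrow> 0 \<le> lam m" "\<And>m. m \<ge> M \<Longrightarrow> lam m \<le> 1/6"
    using vs_graph_eigenvalue_eventually_small[OF assms] by blast
  have "summable (\<lambda>n. lam (Suc n))"
  proof (rule summable_ratio_test[where c = "1/8" and N = M])
    fix n assume "n \<ge> M"
    then show "norm (lam (Suc (Suc n))) \<le> 1/8 * norm (lam (Suc n))"
      using vs_R_ge[of "lam (Suc (Suc n))"] M[of "Suc (Suc n)"] M(1)[of "Suc n"]
        vs_eigenfunction_R[OF assms, of "Suc n"] by simp
  qed simp
  then have "summable (\<lambda>n. 5 * lam (Suc n))" by (rule summable_mult)
  then have "summable (\<lambda>n. norm (vs_N (lam (Suc n)) - 1))"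
    by (rule summable_comparison_test'[where N = M])
      (use M vs_N_minus_1_bound in simp)
  then show ?thesis
    by (intro abs_convergent_prod_imp_convergent_prod summable_imp_abs_convergent_prod)
qed

section \<open>Riemann sums on the Vicsek set\<close>

text \<open>As the fixed point of \<open>vs_F i\<close>, the point \<open>vs_q i\<close> stays in
  every approximation \<open>vs_S n\<close>.\<close>

lemma vs_q_vicsek_set: "i \<in> {0..4} \<Longrightarrow> vs_q i \<in> vicsek_set"
proof -
  assume i: "i \<in> {0..4}"
  have "vs_q i \<in> vs_S n" for n
  proof (induction n)
    case 0
    then show ?case using vs_q_square by (simp add: vs_S_def)
  next
    case (Suc n)
    then have "vs_F i (vs_q i) \<in> vs_S (Suc n)"
      using i unfolding vs_S_Suc vs_T_def by blast
    then show ?case by (simp add: vs_F_q)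
  qed
  then show ?thesis unfolding vicsek_set_eq by blast
qed

lemma vicsek_set_eq_UN: "vicsek_set = (\<Union>w\<in>vs_words m. vs_word_map w ` vicsek_set)"
proof (induction m)
  case 0
  show ?case by (simp add: vs_words_0)
next
  case (Suc m)
  have "vicsek_set = (\<Union>i\<in>{0..4}. vs_F i ` vicsek_set)" by (rule vicsek_set_props(3))
  also have "\<dots> = (\<Union>i\<in>{0..4}. vs_F i ` (\<Union>w\<in>vs_words m. vs_word_map w ` vicsek_set))"
    by (subst Suc) (rule refl)
  also have "\<dots> = (\<Union>w\<in>vs_words (Suc m). vs_word_map w ` vicsek_set)"
    by (force simp: vs_words_Suc)
  finally show ?case .
qed

lemma vs_V_vicsek_set: "vs_V m \<subseteq> vicsek_set"
proof -
  have "vs_V 0 \<subseteq> vicsek_set" using vs_q_vicsek_set by (auto simp: vs_V.simps(1))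
  then have "vs_V m \<subseteq> (\<Union>w\<in>vs_words m. vs_word_map w ` vicsek_set)"
    unfolding vs_V_eq_UN_cell[of m] vs_cell_def by (intro UN_mono image_mono) auto
  then show ?thesis by (simp flip: vicsek_set_eq_UN)
qed

lemma card_vs_words: "card (vs_words m) = 5 ^ m"
proof (induction m)
  case (Suc m)
  have "inj_on (\<lambda>(i, w). i # w) ({0..4::nat} \<times> vs_words m)" by (auto simp: inj_on_def)
  then show ?case
    unfolding vs_words_Suc by (simp add: card_image card_cartesian_product Suc)
qed (simp add: vs_words_0)

lemma vs_square_dist: "x \<in> vs_square \<Longrightarrow> y \<in> vs_square \<Longrightarrow> dist x y \<le> 2"
proof -
  assume xy: "x \<in> vs_square" "y \<in> vs_square"
  obtain a b c d where [simp]: "x = (a, b)" "y = (c, d)" by (metis surj_pair)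
  have "dist x y = norm (a - c, b - d)" by (simp add: dist_norm)
  also have "\<dots> \<le> norm (a - c) + norm (b - d)" by (rule norm_Pair_le)
  also have "\<dots> \<le> 2" using xy by (auto simp: vs_square_def)
  finally show ?thesis .
qed

lemma vicsek_set_borel: "vicsek_set \<in> sets borel"
  by (intro borel_closed compact_imp_closed vicsek_set_props)

lemma vs_word_cell_borel: "vs_word_map w ` vicsek_set \<in> sets borel"
  using vs_word_cell[of w] compact_imp_closed borel_closed by blast

text \<open>A point of the Vicsek set lies in cells of arbitrarily small measure.\<close>

lemma vicsek_measure_vs_V_null:
  assumes mu: "is_vicsek_measure \<mu>"
  shows "vs_V m \<in> null_sets \<mu>"
proof -
  interpret prob_space \<mu> using mu by (simp add: is_vicsek_measure_def)
  have [simp]: "sets \<mu> = sets borel" using mu by (simp add: is_vicsek_measure_def)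
  have pt: "{x} \<in> null_sets \<mu>" if "x \<in> vicsek_set" for x
  proof -
    have "measure \<mu> {x} \<le> (1/5) ^ n" for n
    proof -
      obtain w where w: "w \<in> vs_words n" "x \<in> vs_word_map w ` vicsek_set"
        using \<open>x \<in> vicsek_set\<close> vicsek_set_eq_UN[of n] by blast
      have "measure \<mu> {x} \<le> measure \<mu> (vs_word_map w ` vicsek_set)"
        using w(2) vs_word_cell_borel by (intro finite_measure_mono) auto
      then show ?thesis using mu w(1) by (simp add: is_vicsek_measure_def)
    qed
    moreover have "(\<lambda>n. (1/5::real) ^ n) \<longlonglongrightarrow> 0" by (intro LIMSEQ_realpow_zero) auto
    ultimately have "measure \<mu> {x} \<le> 0" by (intro LIMSEQ_le_const) auto
    then have "measure \<mu> {x} = 0" by (simp add: measure_le_0_iff)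
    then show ?thesis by (simp add: null_sets_def emeasure_eq_measure)
  qed
  have "(\<Union>x\<in>vs_V m. {x}) \<in> null_sets \<mu>"
    using pt vs_V_vicsek_set by (intro null_sets_UN' countable_finite finite_vs_V) blast
  then show ?thesis by simp
qed

text \<open>By \<open>vs_word_map_overlap\<close> distinct cells of one level meet only in vertices
  of that level.\<close>

lemma vs_word_cell_disjoint:
  "disjoint_family_on (\<lambda>w. vs_word_map w ` vicsek_set - vs_V m) (vs_words m)"
  unfolding disjoint_family_on_def
proof (intro ballI impI, rule ccontr)
  fix w w' assume w: "w \<in> vs_words m" "w' \<in> vs_words m" "w \<noteq> w'"
    and "(vs_word_map w ` vicsek_set - vs_V m) \<inter> (vs_word_map w' ` vicsek_set - vs_V m) \<noteq> {}"
  then obtain x where x: "x \<in> vicsek_set" "vs_word_map w x \<in> vs_word_map w' ` vicsek_set"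
      "vs_word_map w x \<notin> vs_V m" by blast
  then have "x \<in> vs_V 0"
    using vs_word_map_overlap[OF w, of x] vicsek_set_square by blast
  then have "vs_word_map w x \<in> vs_V m"
    using w(1) unfolding vs_V_eq_UN_cell[of m] vs_cell_def by blast
  with x(3) show False by blast
qed

text \<open>On small cells uniform continuity keeps \<open>f\<close> within \<open>e / 2\<close> of
  the mean of its four corner values. Deleting the null set \<open>vs_V m\<close> makes the cells
  disjoint without changing their measure 5^(-m), so the errors add up to at most
  \<open>e / 2\<close>.\<close>

lemma vicsek_riemann_sums:
  fixes f :: "real \<times> real \<Rightarrow> real"
  assumes mu: "is_vicsek_measure \<mu>" and f: "continuous_on vicsek_set f"
  shows "(\<lambda>m. 1/4 * (1/5) ^ m * (\<Sum>w\<in>vs_words m. \<Sum>x\<in>vs_cell w. f x))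
    \<longlonglongrightarrow> (LINT x:vicsek_set|\<mu>. f x)"
proof (rule LIMSEQ_I)
  interpret prob_space \<mu> using mu by (simp add: is_vicsek_measure_def)
  have sets [simp, measurable_cong]: "sets \<mu> = sets borel" using mu by (simp add: is_vicsek_measure_def)
  have meas: "set_borel_measurable \<mu> vicsek_set f"
    using borel_measurable_continuous_on_indicator[OF vicsek_set_borel f]
    unfolding set_borel_measurable_def by (simp cong: measurable_cong_sets)
  obtain B where B: "\<And>x. x \<in> vicsek_set \<Longrightarrow> norm (f x) \<le> B"
    using compact_imp_bounded[OF compact_continuous_image[OF f vicsek_set_props(1)]]
    unfolding bounded_iff by blast
  have int: "set_integrable \<mu> vicsek_set f"
    unfolding set_integrable_def
  proof (rule integrable_const_bound)
    show "AE x in \<mu>. norm (indicat_real vicsek_set x *\<^sub>R f x) \<le> max B 0"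
      using B by (intro AE_I2) (auto simp: indicator_def le_max_iff_disj)
    show "(\<lambda>x. indicat_real vicsek_set x *\<^sub>R f x) \<in> borel_measurable \<mu>"
      using meas by (simp add: set_borel_measurable_def)
  qed
  fix e :: real assume e: "0 < e"
  obtain d where d: "d > 0" "\<And>x y. x \<in> vicsek_set \<Longrightarrow> y \<in> vicsek_set \<Longrightarrow> dist x y < d \<Longrightarrow>
      dist (f x) (f y) < e / 2"
    using compact_uniformly_continuous[OF f vicsek_set_props(1)] e
    unfolding uniformly_continuous_on_def by (metis half_gt_zero)
  \<comment> \<open>Half of \<open>d\<close>, because points of the unit square are at most 2 apart
    by \<open>vs_square_dist\<close>.\<close>
  obtain M where M: "(1/3::real) ^ M < d / 2"
    using real_arch_pow_inv[of "d/2" "1/3"] d(1) by auto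
  have "norm (1/4 * (1/5) ^ m * (\<Sum>w\<in>vs_words m. \<Sum>x\<in>vs_cell w. f x) - (LINT x:vicsek_set|\<mu>. f x)) < e"
    if m: "m \<ge> M" for m
  proof -
    define A where "A w = vs_word_map w ` vicsek_set - vs_V m" for w
    have V: "vs_V m \<in> sets borel" using finite_vs_V by (simp add: finite_imp_closed)
    have A [measurable]: "A w \<in> sets \<mu>" for w
      unfolding A_def using vs_word_cell_borel V by auto
    have mA: "measure \<mu> (A w) = (1/5) ^ m" if "w \<in> vs_words m" for w
      unfolding A_def using measure_Diff_null_set[OF _ vicsek_measure_vs_V_null[OF mu]]
        vs_word_cell_borel mu that by (simp add: is_vicsek_measure_def)
    have sub: "A w \<subseteq> vicsek_set" if "w \<in> vs_words m" for w
      using vicsek_set_eq_UN[of m] that unfolding A_def by blast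
    have intA: "set_integrable \<mu> (A w) f" if "w \<in> vs_words m" for w
      by (rule set_integrable_subset[OF int A sub[OF that]])
    have UN: "(\<Union>w\<in>vs_words m. A w) = vicsek_set - vs_V m"
      unfolding A_def using vicsek_set_eq_UN[of m] by blast
    have "(LINT x:vicsek_set|\<mu>. f x) = (LINT x:vicsek_set - vs_V m|\<mu>. f x)"
    proof (rule set_integral_cong_set)
      have "set_integrable \<mu> (vicsek_set - vs_V m) f"
        using V vicsek_set_borel by (intro set_integrable_subset[OF int]) auto
      then show "set_borel_measurable \<mu> (vicsek_set - vs_V m) f"
        unfolding set_integrable_def set_borel_measurable_def by (rule borel_measurable_integrable)
      show "AE x in \<mu>. x \<in> vicsek_set - vs_V m \<longleftrightarrow> x \<in> vicsek_set"
        using AE_not_in[OF vicsek_measure_vs_V_null[OF mu, of m]] by eventually_elim blast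
    qed (rule meas)
    also have "\<dots> = (\<Sum>w\<in>vs_words m. LINT x:A w|\<mu>. f x)"
      unfolding UN[symmetric]
    proof (rule set_integral_finite_Union)
      show "disjoint_family_on A (vs_words m)"
        using vs_word_cell_disjoint[of m] unfolding A_def .
    qed (use intA A in auto)
    finally have split: "(LINT x:vicsek_set|\<mu>. f x) = (\<Sum>w\<in>vs_words m. LINT x:A w|\<mu>. f x)" .
    have cell: "\<bar>(1/5) ^ m * (1/4 * (\<Sum>x\<in>vs_cell w. f x)) - (LINT x:A w|\<mu>. f x)\<bar> \<le> (1/5) ^ m * (e / 2)"
      if w: "w \<in> vs_words m" for w
    proof -
      define c where "c = 1/4 * (\<Sum>x\<in>vs_cell w. f x)"
      have near: "\<bar>f x - c\<bar> \<le> e / 2" if x: "x \<in> A w" for x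
      proof -
        obtain x' where x': "x' \<in> vicsek_set" "x = vs_word_map w x'" using x by (auto simp: A_def)
        have "\<bar>f x - f y\<bar> \<le> e / 2" if y: "y \<in> vs_cell w" for y
        proof -
          obtain y' where y': "y' \<in> vs_V 0" "y = vs_word_map w y'" using y by (auto simp: vs_cell_def)
          have "dist x y = (1/3) ^ m * dist x' y'"
            using w by (simp add: x' y' dist_vs_word_map vs_words_def)
          also have "\<dots> \<le> (1/3) ^ M * 2"
            using vs_square_dist[of x' y'] x'(1) y'(1) vicsek_set_square vs_V_square m
            by (intro mult_mono power_decreasing) auto
          also have "\<dots> < d" using M by simp
          finally have "dist x y < d" .
          moreover have "y \<in> vicsek_set"
            using y w vs_V_vicsek_set[of m] unfolding vs_V_eq_UN_cell by blast
          moreover have "x \<in> vicsek_set" using sub[OF w] x by blast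
          ultimately show ?thesis using d(2)[of x y] by (simp add: dist_real_def)
        qed
        then have "\<bar>\<Sum>y\<in>vs_cell w. f x - f y\<bar> \<le> (\<Sum>y\<in>vs_cell w. e / 2)"
          by (rule order_trans[OF sum_abs sum_mono])
        then show ?thesis by (simp add: c_def sum_subtractf card_vs_cell abs_le_iff field_simps)
      qed
      have const: "set_integrable \<mu> (A w) (\<lambda>x. k)" "(LINT x:A w|\<mu>. k) = (1/5) ^ m * k" for k :: real
      proof -
        have ind: "integrable \<mu> (indicat_real (A w))"
          by (rule integrable_real_indicator[OF A]) (simp add: emeasure_eq_measure)
        then show "set_integrable \<mu> (A w) (\<lambda>x. k)"
          unfolding set_integrable_def by (intro integrable_scaleR_left) simp
        show "(LINT x:A w|\<mu>. k) = (1/5) ^ m * k"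
          using ind mA[OF w] sets.sets_into_space[OF A[of w]] unfolding set_lebesgue_integral_def
          by (simp add: Int_absorb2 inf_absorb1)
      qed
      have near': "f x \<le> c + e / 2" "c - e / 2 \<le> f x" if "x \<in> A w" for x
        using near[OF that] unfolding abs_le_iff by simp_all
      have "(LINT x:A w|\<mu>. f x) \<le> (LINT x:A w|\<mu>. c + e / 2)"
        by (intro set_integral_mono intA[OF w] const near')
      moreover have "(LINT x:A w|\<mu>. c - e / 2) \<le> (LINT x:A w|\<mu>. f x)"
        by (intro set_integral_mono intA[OF w] const near')
      ultimately show ?thesis
        unfolding const c_def[symmetric] abs_le_iff by (simp add: algebra_simps)
    qed
    have "1/4 * (1/5) ^ m * (\<Sum>w\<in>vs_words m. \<Sum>x\<in>vs_cell w. f x) - (LINT x:vicsek_set|\<mu>. f x)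
        = (\<Sum>w\<in>vs_words m. (1/5) ^ m * (1/4 * (\<Sum>x\<in>vs_cell w. f x)) - (LINT x:A w|\<mu>. f x))"
      unfolding split sum_subtractf sum_distrib_left[symmetric] by simp
    also have "\<bar>\<dots>\<bar> \<le> (\<Sum>w\<in>vs_words m. (1/5) ^ m * (e / 2))"
      by (rule order_trans[OF sum_abs]) (intro sum_mono cell)
    also have "\<dots> = e / 2" by (simp add: card_vs_words power_divide)
    also have "\<dots> < e" using e by simp
    finally show ?thesis by simp
  qed
  then show "\<exists>M. \<forall>m\<ge>M. norm (1/4 * (1/5) ^ m * (\<Sum>w\<in>vs_words m. \<Sum>x\<in>vs_cell w. f x)
      - (LINT x:vicsek_set|\<mu>. f x)) < e" by blast
qed

section \<open>The integral as an infinite product\<close>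

lemma vs_inner_LIMSEQ:
  assumes "is_vicsek_measure \<mu>" "continuous_on vicsek_set u" "continuous_on vicsek_set v"
  shows "(\<lambda>m. vs_inner m u v) \<longlonglongrightarrow> (LINT x:vicsek_set|\<mu>. u x * v x)"
  unfolding vs_inner_cell
  by (rule vicsek_riemann_sums[OF assms(1)]) (intro continuous_intros assms)

lemma vs_inner_eq_prod:
  assumes "vs_eigenfunction 0 u lam" "vs_eigenfunction 0 v lam"
  shows "vs_inner m u v = vs_inner 0 u v * (\<Prod>n<m. vs_N (lam (Suc n)))"
proof (induction m)
  case (Suc m)
  then show ?case
    using vs_eigenfunction_inner[of 0 "Suc m" u lam v lam] assms by simp
qed simp

lemma vicsek_integral_eq_prod:
  assumes u: "vs_eigenfunction 0 u lam" and v: "vs_eigenfunction 0 v lam"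
    and mu: "is_vicsek_measure \<mu>"
  shows "(LINT x:vicsek_set|\<mu>. u x * v x) = vs_inner 0 u v * (\<Prod>n. vs_N (lam (Suc n)))"
proof (rule LIMSEQ_unique)
  \<comment> \<open>The shift to \<open>Suc m\<close> matches \<open>convergent_prod_LIMSEQ\<close>,
    whose partial products include the factor with index \<open>m\<close>.\<close>
  show "(\<lambda>m. vs_inner (Suc m) u v) \<longlonglongrightarrow> (LINT x:vicsek_set|\<mu>. u x * v x)"
    using vs_inner_LIMSEQ[OF mu, of u v] u v
    by (intro LIMSEQ_Suc) (simp add: vs_eigenfunction_def)
  show "(\<lambda>m. vs_inner (Suc m) u v) \<longlonglongrightarrow> vs_inner 0 u v * (\<Prod>n. vs_N (lam (Suc n)))"
    unfolding vs_inner_eq_prod[OF u v, of "Suc _"] lessThan_Suc_atMost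
    by (intro tendsto_mult_left convergent_prod_LIMSEQ convergent_prod_vs_N[OF u])
qed

theorem theorem2p3:
  shows
    "(\<forall>m m' u v lam_u lam_v.
        1 \<le> m \<and> m' < m \<and>
        vs_eigenfunction m' u lam_u \<and> vs_eigenfunction m' v lam_v \<and>
        lam_u (m - 1) = lam_v (m - 1) \<and> lam_u m = lam_v m \<longrightarrow>
        vs_inner m u v = vs_N (lam_u m) * vs_inner (m - 1) u v) \<and>
     (\<forall>u v lam_u lam_v \<mu>.
        vs_eigenfunction 0 u lam_u \<and> vs_eigenfunction 0 v lam_v \<and>
        vs_eigenvalue lam_u = vs_eigenvalue lam_v \<and> is_vicsek_measure \<mu> \<longrightarrow>
        convergent_prod (\<lambda>n. vs_N (lam_u (Suc n))) \<and>
        (LINT x:vicsek_set|\<mu>. u x * v x) =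
          vs_inner 0 u v * (\<Prod>n. vs_N (lam_u (Suc n))))"
proof (intro conjI allI impI; (elim conjE)?)
  fix m m' :: nat and u v lam_u lam_v
  assume "m' < m" "vs_eigenfunction m' u lam_u" "vs_eigenfunction m' v lam_v"
    "lam_u (m - 1) = lam_v (m - 1)" "lam_u m = lam_v m"
  then show "vs_inner m u v = vs_N (lam_u m) * vs_inner (m - 1) u v"
    by (rule vs_eigenfunction_inner)
next
  fix u v lam_u lam_v \<mu>
  assume u: "vs_eigenfunction 0 u lam_u" and v: "vs_eigenfunction 0 v lam_v"
    and eq: "vs_eigenvalue lam_u = vs_eigenvalue lam_v" and mu: "is_vicsek_measure \<mu>"
  show "convergent_prod (\<lambda>n. vs_N (lam_u (Suc n)))"
    by (rule convergent_prod_vs_N[OF u])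
  \<comment> \<open>Equal eigenvalues force equal graph eigenvalues on every level, so one sequence
    serves both functions.\<close>
  have "vs_eigenfunction 0 v lam_u" using v vs_eigenvalue_inj[OF u v eq] by simp
  then show "(LINT x:vicsek_set|\<mu>. u x * v x) = vs_inner 0 u v * (\<Prod>n. vs_N (lam_u (Suc n)))"
    by (rule vicsek_integral_eq_prod[OF u _ mu])
qed

end
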